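(* For integers $n\ge 1$ and $w\ge 0$ let $\operatorname{Corank}[1](w,2n)$ denote the dimension of the first homology group of $0\leftarrow C_{1,w}\xleftarrow{\ \partial\ } C_{2,w}$ on the symplectic torus $\mathbb{T}^{2n}$, i.e. $\operatorname{Corank}[1](w,2n)=\dim C_{1,w}-\operatorname{rank}(\partial: C_{2,w}\to C_{1,w})$. Then $\operatorname{Corank}[1](0,2n)=1$, and for $n\ge 2$ and every weight $w$, $$\operatorname{Corank}[1](w,2n)=4+4\sum_{i=1}^{w}\operatorname{Corank}[1](i,2n-2)-3\operatorname{Corank}[1](w,2n-2).$$
   Context: Fix $n\ge1$, let $\mathbb{T}^{2n}=\mathbb{R}^{2n}/(2\pi\mathbb{Z})^{2n}$ with coordinates $x_1,\dots,x_{2n}$, and regard functions on it as functions on $\mathbb{R}^{2n}$ that are $2\pi$-periodic in each variable. For $a_i,b_i\in\mathbb{N}=\{0,1,2,\dots\}$ put $$z[a_1,\dots,a_{2n},b_1,\dots,b_{2n}]=\sin^{a_1}x_1\cdots\sin^{a_{2n}}x_{2n}\,\cos^{b_1}x_1\cdots\cos^{b_{2n}}x_{2n}.$$ Let $W_k$ be the real span of all such functions with $\sum_i(a_i+b_i)\le k$, and let $V_k\subset W_k$ be the span of those with $\sum_i(a_i+b_i)=k$, $a_i\in\mathbb{N}$ and $b_i\in\{0,1\}$. Then $W_k=V_k\oplus W_{k-1}$ (with $W_{-1}=0$), and $W_\infty=\bigcup_k W_k=\bigoplus_{k\ge0}V_k$; here $V_0=\mathbb{R}$ (constants). The standard Poisson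 bracket is $\{F,G\}=\sum_{i=1}^{n}\left(\frac{\partial F}{\partial x_{2i-1}}\frac{\partial G}{\partial x_{2i}}-\frac{\partial F}{\partial x_{2i}}\frac{\partial G}{\partial x_{2i-1}}\right)$. For $F\in V_f$, $G\in V_g$ one has $\{F,G\}\in W_{f+g}=V_{f+g}\oplus W_{f+g-1}$; let $\{F,G\}_{top}\in V_{f+g}$ be the $V_{f+g}$-component. Extended bilinearly, $\{\cdot,\cdot\}_{top}$ is a Lie bracket on $\bigoplus_j V_j$; elements of $V_j$ are said to have weight $j$. Chain spaces: for $w\ge0$, $C_{1,w}=V_w$ (in particular $C_{1,0}=V_0=\mathbb{R}$). For $m\ge2$, $C_{m,w}$ is the subspace of $\Lambda^m\left(\bigoplus_{j\ge1}V_j\right)$ of total weight $w$, i.e. spanned by $\xi_1\wedge\cdots\wedge\xi_m$ with $\xi_i\in V_{j_i}$, $j_i\ge1$, $j_1+\cdots+j_m=w$ (so $C_{2,0}=0$). The boundary operator is $$\partial(\xi_1\wedge\cdots\wedge\xi_m)=\sum_{i<j}(-1)^{i+j}\{\xi_i,\xi_j\}_{top}\wedge\xi_1\wedge\cdots\widehat{\xi_i}\cdots\widehat{\xi_j}\cdots\wedge\xi_m,$$ which preserves weight; in particular $\partial(\xi_1\wedge\xi_2)=-\{\xi_1,\xi_2\}_{top}$. When $\operatorname{Corank}[1](w,2n-2)$ is written, the same construction is carried out on $\mathbb{T}^{2n-2}$. *)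

theory Defs
  imports "HOL-Analysis.Analysis" "HOL-Library.Function_Algebras"
begin

text \<open>
  Functions into a real vector space form a real vector space under the pointwise operations
  (the additive structure is that of \<^theory>\<open>HOL-Library.Function_Algebras\<close>), so that
  \<^const>\<open>span\<close> and \<^const>\<open>dim\<close> of the library apply to spaces of functions.
\<close>

instantiation "fun" :: (type, real_vector) real_vector
begin

definition scaleR_fun :: "real \<Rightarrow> ('a \<Rightarrow> 'b) \<Rightarrow> 'a \<Rightarrow> 'b" where
  "scaleR_fun c f = (\<lambda>x. c *\<^sub>R f x)"

instance
  by standard (simp_all add: scaleR_fun_def plus_fun_def fun_eq_iff scaleR_add_right scaleR_add_left)

end

subsection \<open>Exterior square of a subspace\<close>

text \<open>
  The exterior square of a subspace \<open>U\<close> is the quotient of the free vector space on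
  \<open>U \<times> U\<close> (finitely supported functions, with basis \<open>free_gen u v\<close>) by the subspace
  \<open>ext2_rel U\<close> of bilinearity and alternation relations; its elements are the cosets.
\<close>

definition free_gen :: "'v \<Rightarrow> 'v \<Rightarrow> ('v \<times> 'v \<Rightarrow> real)" where
  "free_gen u v = (\<lambda>p. if p = (u, v) then 1 else 0)"

definition ext2_rel :: "'v::real_vector set \<Rightarrow> ('v \<times> 'v \<Rightarrow> real) set" where
  "ext2_rel U = span
     ({free_gen (u + u') v - free_gen u v - free_gen u' v | u u' v. u \<in> U \<and> u' \<in> U \<and> v \<in> U}
    \<union> {free_gen u (v + v') - free_gen u v - free_gen u v' | u v v'. u \<in> U \<and> v \<in> U \<and> v' \<in> U}
    \<union> {free_gen (c *\<^sub>R u) v - c *\<^sub>R free_gen u v | c u v. u \<in> U \<and> v \<in> U}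
    \<union> {free_gen u (c *\<^sub>R v) - c *\<^sub>R free_gen u v | c u v. u \<in> U \<and> v \<in> U}
    \<union> {free_gen u u | u. u \<in> U})"

text \<open>
  \<open>ext2_coset U (free_gen u v)\<close> is the wedge of \<open>u\<close> and \<open>v\<close>.
\<close>

definition ext2_coset :: "'v::real_vector set \<Rightarrow> ('v \<times> 'v \<Rightarrow> real) \<Rightarrow> ('v \<times> 'v \<Rightarrow> real) set" where
  "ext2_coset U t = {t + r | r. r \<in> ext2_rel U}"

subsection \<open>Trigonometric polynomials on the torus\<close>

text \<open>
  Throughout, \<open>n\<close> is half the dimension of the torus. A function on the torus of dimension
  \<open>2 * n\<close> is regarded as a function of \<open>x :: nat \<Rightarrow> real\<close> that depends only on the
  coordinates \<open>x 1, \<dots>, x (2 * n)\<close>, so that tori of all dimensions share one type.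
\<close>

type_synonym tfun = "(nat \<Rightarrow> real) \<Rightarrow> real"

definition z :: "nat \<Rightarrow> (nat \<Rightarrow> nat) \<Rightarrow> (nat \<Rightarrow> nat) \<Rightarrow> tfun" where
  "z n a b = (\<lambda>x. (\<Prod>i=1..2*n. sin (x i) ^ a i) * (\<Prod>i=1..2*n. cos (x i) ^ b i))"

definition W :: "nat \<Rightarrow> nat \<Rightarrow> tfun set" where
  "W n k = span {z n a b | a b. (\<Sum>i=1..2*n. a i + b i) \<le> k}"

definition V :: "nat \<Rightarrow> nat \<Rightarrow> tfun set" where
  "V n k = span {z n a b | a b. (\<Sum>i=1..2*n. a i + b i) = k \<and> (\<forall>i\<in>{1..2*n}. b i \<in> {0, 1})}"

text \<open>\<open>W_pred n k\<close> is \<open>W n (k - 1)\<close>, with the convention that \<open>W n (-1)\<close> is zero.\<close>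

definition W_pred :: "nat \<Rightarrow> nat \<Rightarrow> tfun set" where
  "W_pred n k = (if k = 0 then {0} else W n (k - 1))"

text \<open>The \<open>V n k\<close>-component of an element of \<open>W n k\<close>, which is the direct sum of
  \<open>V n k\<close> and \<open>W_pred n k\<close>.\<close>

definition top_part :: "nat \<Rightarrow> nat \<Rightarrow> tfun \<Rightarrow> tfun" where
  "top_part n k F = (THE H. H \<in> V n k \<and> F - H \<in> W_pred n k)"

text \<open>The family of components of an element of the direct sum of all \<open>V n j\<close>.\<close>

definition components :: "nat \<Rightarrow> tfun \<Rightarrow> nat \<Rightarrow> tfun" where
  "components n F = (THE c. (\<forall>j. c j \<in> V n j) \<and> finite {j. c j \<noteq> 0} \<and> F = (\<Sum>j | c j \<noteq> 0. c j))"

subsection \<open>Poisson bracket\<close>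

definition partial :: "nat \<Rightarrow> tfun \<Rightarrow> tfun" where
  "partial i F = (\<lambda>x. deriv (\<lambda>t. F (x(i := t))) (x i))"

definition poisson :: "nat \<Rightarrow> tfun \<Rightarrow> tfun \<Rightarrow> tfun" where
  "poisson n F G = (\<Sum>i=1..n. partial (2*i-1) F * partial (2*i) G - partial (2*i) F * partial (2*i-1) G)"

definition bracket_top :: "nat \<Rightarrow> tfun \<Rightarrow> tfun \<Rightarrow> tfun" where
  "bracket_top n F G =
     (\<Sum>f | components n F f \<noteq> 0. \<Sum>g | components n G g \<noteq> 0.
        top_part n (f + g) (poisson n (components n F f) (components n G g)))"

subsection \<open>Chain spaces, boundary operator and first homology\<close>

definition C1 :: "nat \<Rightarrow> nat \<Rightarrow> tfun set" where
  "C1 n w = V n w"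

definition V_pos :: "nat \<Rightarrow> tfun set" where
  "V_pos n = span (\<Union>j\<in>{1..}. V n j)"

text \<open>The image in the quotient of the span of the generators is the span of the wedges.\<close>

definition C2 :: "nat \<Rightarrow> nat \<Rightarrow> (tfun \<times> tfun \<Rightarrow> real) set set" where
  "C2 n w = ext2_coset (V_pos n) `
     span {free_gen \<xi> \<eta> | \<xi> \<eta>. \<exists>i j. 1 \<le> i \<and> 1 \<le> j \<and> i + j = w \<and> \<xi> \<in> V n i \<and> \<eta> \<in> V n j}"

text \<open>
  The boundary sends the wedge of \<open>\<xi>\<close> and \<open>\<eta>\<close> to \<open>- bracket_top n \<xi> \<eta>\<close>. It is
  first extended linearly to the free vector space; the value on a coset is the common value on
  its representatives.
\<close>

definition boundary_free :: "nat \<Rightarrow> (tfun \<times> tfun \<Rightarrow> real) \<Rightarrow> tfun" where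
  "boundary_free n t = (\<Sum>p | t p \<noteq> 0. t p *\<^sub>R (- bracket_top n (fst p) (snd p)))"

definition boundary :: "nat \<Rightarrow> (tfun \<times> tfun \<Rightarrow> real) set \<Rightarrow> tfun" where
  "boundary n c = the_elem (boundary_free n ` c)"

text \<open>\<open>Corank1 w n\<close> is the corank at weight \<open>w\<close> on the torus of dimension \<open>2 * n\<close>.\<close>

definition Corank1 :: "nat \<Rightarrow> nat \<Rightarrow> int" where
  "Corank1 w n = int (dim (C1 n w)) - int (dim (boundary n ` C2 n w))"

end

theory Submission
  imports Defs
begin

text \<open>
  Take the basis of trigonometric monomials in which every variable occurs as \<open>sin\<^sup>m\<close> or
  \<open>sin\<^sup>m\<^sup>-\<^sup>1 cos\<close>. Up to terms of lower weight and scalars, it is closed under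
  multiplication, and the derivative exchanges the two monomials of degree \<open>m\<close> with a factor
  \<open>\<plusminus>m\<close>. A summand of the Poisson bracket of two monomials vanishes unless both variables of a
  conjugate pair occur, so the boundaries lie in the span of the monomials in which some conjugate
  pair occurs; each of these is a boundary, by splitting off a single \<open>sin\<close> or \<open>cos\<close>.
  Hence the corank counts the monomials in which no conjugate pair occurs. For a single pair of
  variables there are one such monomial of degree \<open>0\<close> and four in each positive degree, which gives
  the recursion.
\<close>

text \<open>That boundaries lie in the mixed span needs no exact products: it suffices to bound the
  degree in each variable separately. A term of full weight attains every bound, so it keeps each
  variable that occurs in a factor. The converse needs an exact leading coefficient. Coding the two
  monomials of degree \<open>m\<close> by \<open>m\<close> and \<open>-m\<close> makes the
  derivative uniform: \<open>trig_mono m\<close> goes to \<open>m\<close> times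
  \<open>trig_mono (-m)\<close> plus terms of lower degree, for either sign. This factor is nonzero
  if the variable occurs, so it can be divided out, and terms of lower weight vanish in the top
  part. Two obstacles shape the rest. \<open>deriv\<close> is additive only on differentiable
  functions, so bilinearity of the bracket is established on trigonometric polynomials; and the
  boundary is defined through representatives of cosets, so it has to be shown to vanish on the
  relations. For generating functions in the weight, the recursion is multiplication by 1 + 4t +
  4t^2 + ... = (1 + 3t)/(1 - t).\<close>

lemma scaleR_fun_apply [simp]: "(c *\<^sub>R F) x = c *\<^sub>R F x"
  by (simp add: scaleR_fun_def)

lemma sum_fun_apply: "(\<Sum>i\<in>A. F i) x = (\<Sum>i\<in>A. F i x)"
  by (induction A rule: infinite_finite_induct) auto

section \<open>Induction and linear maps on spans\<close>

lemma span_induct_linear [consumes 1, case_names base zero add scale]: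
  assumes "F \<in> span A"
    and "\<And>a. a \<in> A \<Longrightarrow> P a"
    and "P 0"
    and "\<And>F G. P F \<Longrightarrow> P G \<Longrightarrow> P (F + G)"
    and "\<And>c F. P F \<Longrightarrow> P (c *\<^sub>R F)"
  shows "P F"
proof -
  have "subspace {F. P F}"
    using assms(3-5) by (auto simp: subspace_def)
  then have "span A \<subseteq> {F. P F}"
    using assms(2) by (intro span_minimal) auto
  then show ?thesis using assms(1) by auto
qed

lemma linear_in_span:
  assumes "linear f" "\<And>a. a \<in> A \<Longrightarrow> f a \<in> span B" "x \<in> span A"
  shows "f x \<in> span B"
proof -
  have "f x \<in> span (f ` A)"
    using assms(1,3) by (metis imageI linear_span_image)
  also have "\<dots> \<subseteq> span B"
    using assms(2) by (intro span_minimal) auto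
  finally show ?thesis .
qed

lemma bilinear_in_span:
  assumes "\<And>y. linear (\<lambda>x. f x y)" "\<And>x. linear (f x)"
    and "\<And>a b. a \<in> A \<Longrightarrow> b \<in> B \<Longrightarrow> f a b \<in> span C"
    and "x \<in> span A" "y \<in> span B"
  shows "f x y \<in> span C"
  using linear_in_span[of "\<lambda>x. f x y" A C x] linear_in_span[OF assms(2,3,5)] assms(1,4) by blast

subsection \<open>Trigonometric monomials in one variable\<close>

text \<open>For \<open>m < 0\<close> the monomial has degree \<open>- m\<close> and contains one factor \<open>cos\<close>, so the
  degree is \<open>\<bar>m\<bar>\<close> throughout.\<close>

definition trig_mono :: "int \<Rightarrow> real \<Rightarrow> real" where
  "trig_mono m t = (if m \<ge> 0 then sin t ^ nat m else sin t ^ (nat (- m) - 1) * cos t)"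

lemma trig_mono_0 [simp]: "trig_mono 0 = (\<lambda>t. 1)"
  by (simp add: trig_mono_def fun_eq_iff)

text \<open>A combination has the form P(sin t) + cos t Q(sin t). The reflection t -> pi - t fixes
  sin and negates cos, so both summands vanish separately, and P and Q have infinitely many
  roots.\<close>

lemma trig_mono_independent:
  assumes K: "finite K" and eq: "\<And>t. (\<Sum>m\<in>K. c m * trig_mono m t) = 0" and m: "m \<in> K"
  shows "c m = 0"
proof -
  define P where "P = (\<Sum>m\<in>{m\<in>K. m \<ge> 0}. Polynomial.monom (c m) (nat m))"
  define Q where "Q = (\<Sum>m\<in>{m\<in>K. m < 0}. Polynomial.monom (c m) (nat (- m) - 1))"
  have split: "poly P (sin t) + cos t * poly Q (sin t) = 0" for t
  proof -
    have "(\<Sum>m\<in>K. c m * trig_mono m t)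
        = (\<Sum>m\<in>{m\<in>K. m \<ge> 0}. c m * trig_mono m t) + (\<Sum>m\<in>{m\<in>K. m < 0}. c m * trig_mono m t)"
      by (subst sum.union_disjoint[symmetric]) (use K in \<open>auto intro!: sum.cong\<close>)
    also have "\<dots> = poly P (sin t) + cos t * poly Q (sin t)"
      unfolding P_def Q_def poly_sum poly_monom sum_distrib_left
      by (intro arg_cong2[where f="(+)"] sum.cong) (auto simp: trig_mono_def)
    finally show ?thesis using eq[of t] by simp
  qed
  \<comment> \<open>On the open interval cos (arcsin s) is positive and can be cancelled.\<close>
  have zero: "poly P s = 0 \<and> poly Q s = 0" if s: "s \<in> {-1<..<1}" for s
  proof -
    have s': "sin (arcsin s) = s" "cos (arcsin s) > 0"
      using s arcsin_lt_bounded[of s] by (auto intro!: cos_gt_zero_pi)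
    have "poly P s + cos (arcsin s) * poly Q s = 0"
      using split[of "arcsin s"] s' by simp
    moreover have "poly P s - cos (arcsin s) * poly Q s = 0"
      using split[of "pi - arcsin s"] s' by (simp add: sin_diff cos_diff)
    ultimately have "poly P s = 0" "cos (arcsin s) * poly Q s = 0" by linarith+
    then show ?thesis using s' by simp
  qed
  have inf: "infinite {-1<..<1::real}" by (rule infinite_Ioo) simp
  have "P = 0" "Q = 0"
  proof -
    show "P = 0"
      by (rule ccontr, drule poly_roots_finite) (metis (lifting) zero inf finite_subset mem_Collect_eq subsetI)
    show "Q = 0"
      by (rule ccontr, drule poly_roots_finite) (metis (lifting) zero inf finite_subset mem_Collect_eq subsetI)
  qed
  show ?thesis
  proof (cases "m \<ge> 0")
    case True
    have "coeff P (nat m) = (\<Sum>k\<in>{m\<in>K. m \<ge> 0}. if k = m then c k else 0)"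
      unfolding P_def coeff_sum by (rule sum.cong) (use True in auto)
    also have "\<dots> = c m" using K m True by (subst sum.delta) auto
    finally show ?thesis using \<open>P = 0\<close> by simp
  next
    case False
    have "coeff Q (nat (- m) - 1) = (\<Sum>k\<in>{m\<in>K. m < 0}. if k = m then c k else 0)"
      unfolding Q_def coeff_sum by (rule sum.cong) (use False in auto)
    also have "\<dots> = c m" using K m False by (subst sum.delta) auto
    finally show ?thesis using \<open>Q = 0\<close> by simp
  qed
qed

text \<open>A filtration by degree rather than a grading, because cos^2 = 1 - sin^2 produces terms
  of different degrees.\<close>

definition trig_space :: "nat \<Rightarrow> (real \<Rightarrow> real) set" where
  "trig_space k = span (trig_mono ` {m. nat \<bar>m\<bar> \<le> k})"

lemma trig_space_mono: "j \<le> k \<Longrightarrow> trig_space j \<subseteq> trig_space k"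
  unfolding trig_space_def by (intro span_mono image_mono) auto

lemma trig_mono_in_trig_space: "nat \<bar>m\<bar> \<le> k \<Longrightarrow> trig_mono m \<in> trig_space k"
  unfolding trig_space_def by (intro span_base) auto

text \<open>Replacing cos^2 by 1 - sin^2 lowers \<open>b\<close> by two and raises \<open>a\<close>
  by zero or two, so the bound on \<open>a + b\<close> survives; hence the induction on
  \<open>b\<close> with \<open>a\<close> arbitrary.\<close>

lemma sin_cos_power_in_trig_space:
  "a + b \<le> k \<Longrightarrow> (\<lambda>t. sin t ^ a * cos t ^ b) \<in> trig_space k"
proof (induction b arbitrary: a rule: less_induct)
  case (less b)
  consider "b = 0" | "b = 1" | b' where "b = Suc (Suc b')"
    by (metis One_nat_def old.nat.exhaust)
  then show ?case
  proof cases
    case 1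
    have "(\<lambda>t. sin t ^ a * cos t ^ b) = trig_mono (int a)"
      using 1 by (simp add: trig_mono_def fun_eq_iff)
    then show ?thesis using less.prems by (simp add: trig_mono_in_trig_space)
  next
    case 2
    have "(\<lambda>t. sin t ^ a * cos t ^ b) = trig_mono (- int a - 1)"
      using 2 by (auto simp add: trig_mono_def fun_eq_iff nat_add_distrib)
    then show ?thesis using less.prems 2 by (simp add: trig_mono_in_trig_space)
  next
    case 3
    have "(\<lambda>t. sin t ^ a * cos t ^ b)
        = (\<lambda>t::real. sin t ^ a * cos t ^ b') - (\<lambda>t. sin t ^ (a + 2) * cos t ^ b')"
    proof
      fix t :: real
      have "cos t ^ b = cos t ^ b' * (cos t)\<^sup>2" using 3 by (simp add: power2_eq_square)
      also have "\<dots> = cos t ^ b' - (sin t)\<^sup>2 * cos t ^ b'"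
        by (simp add: cos_squared_eq algebra_simps)
      finally have e: "cos t ^ b = cos t ^ b' - (sin t)\<^sup>2 * cos t ^ b'" .
      show "sin t ^ a * cos t ^ b
        = ((\<lambda>t. sin t ^ a * cos t ^ b') - (\<lambda>t. sin t ^ (a + 2) * cos t ^ b')) t"
        unfolding e by (simp add: algebra_simps power2_eq_square)
    qed
    moreover have "(\<lambda>t. sin t ^ a * cos t ^ b') \<in> trig_space k"
      "(\<lambda>t. sin t ^ (a + 2) * cos t ^ b') \<in> trig_space k"
      using less.IH[of b' a] less.IH[of b' "a + 2"] less.prems 3 by simp_all
    ultimately show ?thesis unfolding trig_space_def by (simp add: span_diff)
  qed
qed

lemma trig_mono_mult_in_trig_space: "trig_mono p * trig_mono q \<in> trig_space (nat \<bar>p\<bar> + nat \<bar>q\<bar>)"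
proof -
  have form: "\<exists>a b. a + b = nat \<bar>m\<bar> \<and> trig_mono m = (\<lambda>t. sin t ^ a * cos t ^ b)" for m
  proof (cases "m \<ge> 0")
    case True
    then show ?thesis
      by (intro exI[of _ "nat m"] exI[of _ 0]) (auto simp: trig_mono_def fun_eq_iff)
  next
    case False
    then show ?thesis
      by (intro exI[of _ "nat (- m) - 1"] exI[of _ 1]) (auto simp: trig_mono_def fun_eq_iff)
  qed
  obtain a b a' b' where *: "a + b = nat \<bar>p\<bar>" "trig_mono p = (\<lambda>t. sin t ^ a * cos t ^ b)"
    "a' + b' = nat \<bar>q\<bar>" "trig_mono q = (\<lambda>t. sin t ^ a' * cos t ^ b')"
    using form[of p] form[of q] by auto
  have "trig_mono p * trig_mono q = (\<lambda>t. sin t ^ (a + a') * cos t ^ (b + b'))"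
    by (simp add: * fun_eq_iff power_add)
  also have "\<dots> \<in> trig_space (nat \<bar>p\<bar> + nat \<bar>q\<bar>)"
    using * by (intro sin_cos_power_in_trig_space) auto
  finally show ?thesis .
qed

lemma trig_space_mult:
  assumes "f \<in> trig_space j" "h \<in> trig_space k"
  shows "f * h \<in> trig_space (j + k)"
proof -
  have "linear (\<lambda>f. f * h)" "linear ((*) f)" for f h :: "real \<Rightarrow> real"
    by (auto intro!: linearI simp: fun_eq_iff algebra_simps)
  moreover have "a * b \<in> span (trig_mono ` {m. nat \<bar>m\<bar> \<le> j + k})"
    if ab: "a \<in> trig_mono ` {m. nat \<bar>m\<bar> \<le> j}" "b \<in> trig_mono ` {m. nat \<bar>m\<bar> \<le> k}" for a b
  proof -
    obtain p q where pq: "a = trig_mono p" "b = trig_mono q" "nat \<bar>p\<bar> + nat \<bar>q\<bar> \<le> j + k"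
      using ab by auto
    then show ?thesis
      using trig_mono_mult_in_trig_space[of p q] trig_space_mono[OF pq(3)]
      unfolding trig_space_def by blast
  qed
  ultimately show ?thesis
    using assms unfolding trig_space_def by (rule bilinear_in_span)
qed

text \<open>The second summand is the 1 of cos^2 = 1 - sin^2, which arises on differentiating sin^k
  cos with k = - m - 1; it is absent for k = 0, that is \<open>m = -1\<close>.\<close>

definition trig_mono_deriv :: "int \<Rightarrow> real \<Rightarrow> real" where
  "trig_mono_deriv m = of_int m *\<^sub>R trig_mono (- m)
     + (if m \<le> -2 then of_int (- m - 1) *\<^sub>R trig_mono (- m - 2) else 0)"

lemma trig_mono_deriv_0 [simp]: "trig_mono_deriv 0 = 0"
  by (simp add: trig_mono_deriv_def)

lemma has_field_derivative_trig_mono: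
  "(trig_mono m has_field_derivative trig_mono_deriv m t) (at t)"
proof (cases "m \<ge> 0")
  case True
  have "trig_mono m = (\<lambda>t. sin t ^ nat m)" using True by (simp add: trig_mono_def fun_eq_iff)
  moreover have "((\<lambda>t. sin t ^ nat m) has_field_derivative trig_mono_deriv m t) (at t)"
    by (rule derivative_eq_intros refl)+
      (use True in \<open>auto simp: trig_mono_deriv_def trig_mono_def\<close>)
  ultimately show ?thesis by simp
next
  case False
  define k where "k = nat (- m) - 1"
  have m: "m = - int k - 1" using False by (auto simp: k_def)
  have tm: "trig_mono m = (\<lambda>t. sin t ^ k * cos t)"
    using False by (simp add: trig_mono_def fun_eq_iff k_def)
  have "((\<lambda>t. sin t ^ k * cos t) has_field_derivative trig_mono_deriv m t) (at t)"
  proof (cases k)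
    case 0
    then show ?thesis
      by (auto intro!: derivative_eq_intros simp: trig_mono_deriv_def trig_mono_def m)
  next
    case (Suc l)
    have cc: "cos t * cos t = 1 - sin t * sin t"
      using cos_squared_eq[of t] by (simp add: power2_eq_square)
    have "trig_mono_deriv m t = - real (k + 1) * sin t ^ (k + 1) + real k * sin t ^ l"
      using Suc by (simp add: trig_mono_deriv_def trig_mono_def m nat_add_distrib)
    also have "\<dots> = (real k * sin t ^ (k - 1) * cos t) * cos t + (- sin t) * sin t ^ k"
      unfolding mult.assoc cc using Suc by (simp add: algebra_simps)
    finally have eq: "trig_mono_deriv m t = \<dots>" .
    show ?thesis unfolding eq
      by (rule derivative_eq_intros refl)+ simp
  qed
  then show ?thesis using tm by simp
qed

lemma trig_mono_deriv_lower:
  assumes "m \<noteq> 0"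
  shows "trig_mono_deriv m - of_int m *\<^sub>R trig_mono (- m) \<in> trig_space (nat \<bar>m\<bar> - 1)"
  using assms unfolding trig_mono_deriv_def
  by (auto simp: trig_space_def intro!: span_zero span_scale[OF span_base] imageI)

lemma trig_mono_deriv_in_trig_space: "trig_mono_deriv m \<in> trig_space (nat \<bar>m\<bar>)"
  unfolding trig_mono_deriv_def
  by (auto simp: trig_space_def intro!: span_zero span_add span_scale[OF span_base] imageI)

subsection \<open>Trigonometric monomials on the torus\<close>

text \<open>The factors are arbitrary functions of one variable, so products and partial derivatives
  of monomials, which leave the basis, still have this form before they are expanded.\<close>

definition sep :: "nat set \<Rightarrow> (nat \<Rightarrow> real \<Rightarrow> real) \<Rightarrow> tfun" where
  "sep S h = (\<lambda>x. \<Prod>i\<in>S. h i (x i))"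

lemma sep_cong: "(\<And>i. i \<in> S \<Longrightarrow> h i = h' i) \<Longrightarrow> sep S h = sep S h'"
  by (simp add: sep_def fun_eq_iff)

lemma sep_insert:
  "finite S \<Longrightarrow> a \<notin> S \<Longrightarrow> sep (insert a S) h = (\<lambda>x. h a (x a) * sep S h x)"
  by (simp add: sep_def)

lemma sep_mult: "sep S h * sep S h' = sep S (\<lambda>i. h i * h' i)"
  by (simp add: sep_def fun_eq_iff prod.distrib)

lemma sep_update_linear:
  assumes "finite S" "a \<in> S"
  shows "linear (\<lambda>f. sep S (h(a := f)))"
proof -
  have "sep S (h(a := f)) = (\<lambda>x. f (x a) * (\<Prod>i\<in>S - {a}. h i (x i)))" for f
    unfolding sep_def fun_eq_iff using assms
    by (subst prod.remove[of S a]) (auto intro!: arg_cong2[where f="(*)"] prod.cong)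
  then show ?thesis by (auto intro!: linearI simp: fun_eq_iff algebra_simps)
qed

text \<open>Each factor is expanded in turn. The degree bounds are kept per variable, not merely in
  total: this is what later shows which variables occur in a term of full weight.\<close>

lemma sep_in_span:
  assumes "finite S" "\<And>i. i \<in> S \<Longrightarrow> h i \<in> trig_space (d i)"
  shows "sep S h \<in> span ((\<lambda>M. sep S (\<lambda>i. trig_mono (M i))) `
    {M. (\<forall>i\<in>S. nat \<bar>M i\<bar> \<le> d i) \<and> (\<forall>i. i \<notin> S \<longrightarrow> M i = 0)})"
  using assms
proof (induction S)
  case empty
  have "sep {} h = sep {} (\<lambda>i. trig_mono 0)"
    by (simp add: sep_def)
  then show ?case by (intro span_base image_eqI[of _ _ "\<lambda>_. 0"]) (auto simp: sep_def)
next
  case (insert a S)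
  let ?f = "\<lambda>(f :: real \<Rightarrow> real) (G :: tfun). (\<lambda>x. f (x a) * G x)"
  let ?B = "\<lambda>S. (\<lambda>M. sep S (\<lambda>i. trig_mono (M i))) `
    {M. (\<forall>i\<in>S. nat \<bar>M i\<bar> \<le> d i) \<and> (\<forall>i. i \<notin> S \<longrightarrow> M i = 0)}"
  have "?f (h a) (sep S h) \<in> span (?B (insert a S))"
  proof (rule bilinear_in_span[of ?f "trig_mono ` {m. nat \<bar>m\<bar> \<le> d a}" "?B S"])
    show "linear (\<lambda>f. ?f f G)" "linear (?f f)" for f G
      by (auto intro!: linearI simp: fun_eq_iff algebra_simps)
    show "h a \<in> span (trig_mono ` {m. nat \<bar>m\<bar> \<le> d a})"
      using insert.prems[of a] by (simp add: trig_space_def)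
    show "sep S h \<in> span (?B S)" using insert by simp
  next
    fix f G
    assume f: "f \<in> trig_mono ` {m. nat \<bar>m\<bar> \<le> d a}" and G: "G \<in> ?B S"
    from f obtain m where m: "f = trig_mono m" "nat \<bar>m\<bar> \<le> d a" by auto
    from G obtain M where M: "G = sep S (\<lambda>i. trig_mono (M i))"
      "\<forall>i\<in>S. nat \<bar>M i\<bar> \<le> d i" "\<forall>i. i \<notin> S \<longrightarrow> M i = 0" by blast
    have "?f f G = sep (insert a S) (\<lambda>i. trig_mono ((M(a := m)) i))"
      unfolding sep_insert[OF insert.hyps(1,2)] using insert.hyps m(1) M(1)
      by (auto simp: fun_eq_iff sep_def intro!: prod.cong)
    then show "?f f G \<in> span (?B (insert a S))"
      using m(2) M(2,3) by (intro span_base image_eqI[of _ _ "M(a := m)"]) auto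
  qed
  then show ?case using insert.hyps by (simp add: sep_insert)
qed

text \<open>With the other variables frozen, independence in the single variable \<open>a\<close>
  kills the coefficient of each \<open>trig_mono m\<close>. That coefficient is a combination over
  the indices with entry \<open>m\<close> at \<open>a\<close>, to which the induction hypothesis
  applies.\<close>

lemma sep_trig_mono_independent:
  assumes "finite S" "finite A"
    and "\<And>M M'. M \<in> A \<Longrightarrow> M' \<in> A \<Longrightarrow> (\<And>i. i \<in> S \<Longrightarrow> M i = M' i) \<Longrightarrow> M = M'"
    and "\<And>x. (\<Sum>M\<in>A. c M * sep S (\<lambda>i. trig_mono (M i)) x) = 0"
    and "M \<in> A"
  shows "c M = 0"
  using assms
proof (induction S arbitrary: A M)
  case empty
  \<comment> \<open>With no variables left, all members of \<open>A\<close> agree, and the empty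
    product is 1.\<close>
  have "A = {M}" using empty.prems by auto
  then show ?case using empty.prems(3) by (simp add: sep_def)
next
  case (insert a S)
  let ?E = "\<lambda>M. sep S (\<lambda>i. trig_mono (M i))"
  let ?A = "{M'\<in>A. M' a = M a}"
  have sum_zero: "(\<Sum>M'\<in>?A. c M' * ?E M' x) = 0" for x
  proof -
    have "(\<Sum>m\<in>(\<lambda>M. M a) ` A. (\<Sum>M'\<in>{M'\<in>A. M' a = m}. c M' * ?E M' x) * trig_mono m t) = 0" for t
    proof -
      have E: "?E M (x(a := t)) = ?E M x" for M
        using insert.hyps by (auto simp: sep_def intro!: prod.cong)
      have "0 = (\<Sum>M\<in>A. c M * (trig_mono (M a) t * ?E M x))"
        using insert.prems(3)[of "x(a := t)"]
        by (simp only: sep_insert[OF insert.hyps(1,2)] E fun_upd_same)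
      also have "\<dots> = (\<Sum>m\<in>(\<lambda>M. M a) ` A. \<Sum>M'\<in>{M'\<in>A. M' a = m}. c M' * (trig_mono (M' a) t * ?E M' x))"
        by (rule sum.image_gen[OF insert.prems(1)])
      also have "\<dots> = (\<Sum>m\<in>(\<lambda>M. M a) ` A. (\<Sum>M'\<in>{M'\<in>A. M' a = m}. c M' * ?E M' x) * trig_mono m t)"
        by (auto simp: sum_distrib_right intro!: sum.cong)
      finally show ?thesis by simp
    qed
    then show ?thesis
      using insert.prems(1,4)
      by (intro trig_mono_independent[where c = "\<lambda>m. \<Sum>M'\<in>{M'\<in>A. M' a = m}. c M' * ?E M' x"
            and m = "M a" and K = "(\<lambda>M. M a) ` A"]) auto
  qed
  show ?case
  proof (rule insert.IH[of ?A, OF _ _ sum_zero])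
    fix M1 M2 assume *: "M1 \<in> ?A" "M2 \<in> ?A" "\<And>i. i \<in> S \<Longrightarrow> M1 i = M2 i"
    then have "M1 i = M2 i" if "i \<in> insert a S" for i
      using that by auto
    with * show "M1 = M2" by (intro insert.prems(2)) simp_all
  next
    show "finite ?A" "M \<in> ?A" using insert.prems(1,4) by simp_all
  qed
qed

section \<open>The monomial basis and its relation to the spaces \<open>V\<close> and
  \<open>W\<close>\<close>

definition idx :: "nat \<Rightarrow> (nat \<Rightarrow> int) set" where
  "idx n = {M. \<forall>i. i \<notin> {1..2*n} \<longrightarrow> M i = 0}"

definition trig_monomial :: "nat \<Rightarrow> (nat \<Rightarrow> int) \<Rightarrow> tfun" where
  "trig_monomial n M = sep {1..2*n} (\<lambda>i. trig_mono (M i))"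

definition wt :: "nat \<Rightarrow> (nat \<Rightarrow> int) \<Rightarrow> nat" where
  "wt n M = (\<Sum>i=1..2*n. nat \<bar>M i\<bar>)"

lemma idx_eqI: "M \<in> idx n \<Longrightarrow> M' \<in> idx n \<Longrightarrow> (\<And>i. i \<in> {1..2*n} \<Longrightarrow> M i = M' i) \<Longrightarrow> M = M'"
proof
  fix i
  assume "M \<in> idx n" "M' \<in> idx n" "\<And>i. i \<in> {1..2*n} \<Longrightarrow> M i = M' i"
  then show "M i = M' i"
    by (cases "i \<in> {1..2*n}") (simp_all add: idx_def)
qed

lemma nat_abs_le_wt: "i \<in> {1..2*n} \<Longrightarrow> nat \<bar>M i\<bar> \<le> wt n M"
  unfolding wt_def by (rule member_le_sum) simp_all

lemma finite_idx_wt: "finite {M\<in>idx n. wt n M \<le> k}"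
proof (rule finite_subset[OF _ finite_set_of_finite_funs])
  show "{M\<in>idx n. wt n M \<le> k} \<subseteq>
    {M. \<forall>i. (i \<in> {1..2*n} \<longrightarrow> M i \<in> {- int k..int k}) \<and> (i \<notin> {1..2*n} \<longrightarrow> M i = 0)}"
  proof
    fix M assume M: "M \<in> {M\<in>idx n. wt n M \<le> k}"
    have "M i \<in> {- int k..int k}" if "i \<in> {1..2*n}" for i
    proof -
      have "nat \<bar>M i\<bar> \<le> k" using nat_abs_le_wt[OF that, of M] M by simp
      then show ?thesis by simp linarith
    qed
    then show "M \<in> {M. \<forall>i. (i \<in> {1..2*n} \<longrightarrow> M i \<in> {- int k..int k}) \<and> (i \<notin> {1..2*n} \<longrightarrow> M i = 0)}"
      using M by (simp only: idx_def mem_Collect_eq) blast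
  qed
qed simp_all

lemma inj_on_trig_monomial: "inj_on (trig_monomial n) (idx n)"
proof (rule inj_onI, rule ccontr)
  fix M M' assume *: "M \<in> idx n" "M' \<in> idx n" "trig_monomial n M = trig_monomial n M'" "M \<noteq> M'"
  \<comment> \<open>Coefficients 1 and -1 on two indices with the same function would be a
    dependence; this is its coefficient at \<open>M\<close>, stated in the form of the general
    lemma.\<close>
  have "(if M = M then 1 else -1 :: real) = 0"
  proof (rule sep_trig_mono_independent[of "{1..2*n}" "{M, M'}" "\<lambda>N. if N = M then 1 else -1"])
    fix x show "(\<Sum>N\<in>{M, M'}. (if N = M then 1 else -1) * sep {1..2*n} (\<lambda>i. trig_mono (N i)) x) = 0"
      using * by (simp add: trig_monomial_def)
  next
    fix N N' assume N: "N \<in> {M, M'}" "N' \<in> {M, M'}" "\<And>i. i \<in> {1..2*n} \<Longrightarrow> N i = N' i"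
    have "N \<in> idx n" "N' \<in> idx n" using N(1,2) *(1,2) by auto
    then show "N = N'" using N(3) by (rule idx_eqI)
  qed simp_all
  then show False by simp
qed

lemma independent_trig_monomial: "independent (trig_monomial n ` idx n)"
proof
  assume "dependent (trig_monomial n ` idx n)"
  then obtain T u F where T: "T \<subseteq> trig_monomial n ` idx n" "finite T"
    and sum: "(\<Sum>F\<in>T. u F *\<^sub>R F) = 0" and F: "F \<in> T" and nz: "u F \<noteq> 0"
    unfolding dependent_explicit by blast
  have "F \<in> trig_monomial n ` idx n" using T(1) F by (rule subsetD)
  then obtain M where M: "F = trig_monomial n M" "M \<in> idx n" by (rule imageE)
  obtain A where A: "A \<subseteq> idx n" "finite A" "T = trig_monomial n ` A"
    using finite_subset_image[OF T(2,1)] by blast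
  have inj: "inj_on (trig_monomial n) A" by (rule inj_on_subset[OF inj_on_trig_monomial A(1)])
  obtain M' where M': "M' \<in> A" "F = trig_monomial n M'" using F unfolding A(3) by (rule imageE)
  have "M' \<in> idx n" using M'(1) A(1) by (rule subsetD[rotated])
  have "M = M'"
    by (rule inj_onD[OF inj_on_trig_monomial _ M(2) \<open>M' \<in> idx n\<close>]) (use M M' in simp)
  then have "M \<in> A" using M'(1) by simp
  have "u (trig_monomial n M) = 0"
  proof (rule sep_trig_mono_independent[of "{1..2*n}" A "\<lambda>M. u (trig_monomial n M)", OF _ A(2) _ _ \<open>M \<in> A\<close>])
    fix x
    have "(\<Sum>M\<in>A. u (trig_monomial n M) * trig_monomial n M x) = (\<Sum>F\<in>T. u F * F x)"
      unfolding A(3) sum.reindex[OF inj] by simp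
    also have "\<dots> = (\<Sum>F\<in>T. u F *\<^sub>R F) x" by (simp add: sum_fun_apply)
    also have "\<dots> = 0" unfolding sum by simp
    finally show "(\<Sum>M\<in>A. u (trig_monomial n M) * sep {1..2*n} (\<lambda>i. trig_mono (M i)) x) = 0"
      unfolding trig_monomial_def .
  next
    fix N N' assume N: "N \<in> A" "N' \<in> A" "\<And>i. i \<in> {1..2*n} \<Longrightarrow> N i = N' i"
    have "N \<in> idx n" "N' \<in> idx n" using N(1,2) A(1) by auto
    then show "N = N'" using N(3) by (rule idx_eqI)
  qed simp
  then show False using nz M(1) by simp
qed

lemma sep_in_span_trig_monomial:
  assumes "\<And>i. i \<in> {1..2*n} \<Longrightarrow> h i \<in> trig_space (d i)"
  shows "sep {1..2*n} h \<in> span (trig_monomial n ` {M\<in>idx n. \<forall>i\<in>{1..2*n}. nat \<bar>M i\<bar> \<le> d i})"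
  using sep_in_span[of "{1..2*n}" h d] assms
  by (simp add: trig_monomial_def[abs_def] idx_def conj_commute)

text \<open>Already the generating sets agree: an exponent pair with \<open>b i = 0\<close>
  corresponds to the entry \<open>a i\<close>, one with \<open>b i = 1\<close> to
  \<open>- a i - 1\<close>, whose absolute value counts the cosine.\<close>

lemma V_eq_span_trig_monomial: "V n k = span (trig_monomial n ` {M\<in>idx n. wt n M = k})"
proof -
  have "{z n a b | a b. (\<Sum>i=1..2*n. a i + b i) = k \<and> (\<forall>i\<in>{1..2*n}. b i \<in> {0, 1})}
      = trig_monomial n ` {M\<in>idx n. wt n M = k}" (is "?L = ?R")
  proof safe
    fix a b :: "nat \<Rightarrow> nat"
    assume b: "\<forall>i\<in>{1..2*n}. b i \<in> {0, 1}" and k: "k = (\<Sum>i=1..2*n. a i + b i)"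
    define M where "M = (\<lambda>i. if i \<in> {1..2*n} then (if b i = 0 then int (a i) else - int (a i) - 1) else 0)"
    have "z n a b = sep {1..2*n} (\<lambda>i t. sin t ^ a i * cos t ^ b i)"
      by (simp add: z_def sep_def prod.distrib)
    also have "\<dots> = trig_monomial n M"
      unfolding trig_monomial_def
    proof (rule sep_cong)
      fix i assume i: "i \<in> {1..2*n}"
      then consider "b i = 0" | "b i = 1" using bspec[OF b i] by auto
      then show "(\<lambda>t. sin t ^ a i * cos t ^ b i) = trig_mono (M i)"
        by cases (use i in \<open>simp_all add: M_def trig_mono_def fun_eq_iff nat_add_distrib\<close>)
    qed
    finally have "z n a b = trig_monomial n M" .
    moreover have "wt n M = (\<Sum>i=1..2*n. a i + b i)"
      unfolding wt_def
    proof (rule sum.cong)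
      fix i assume i: "i \<in> {1..2*n}"
      show "nat \<bar>M i\<bar> = a i + b i"
        using bspec[OF b i] i by (auto simp: M_def)
    qed simp
    moreover have "M \<in> idx n" by (simp add: idx_def M_def)
    ultimately show "z n a b \<in> trig_monomial n ` {M\<in>idx n. wt n M = (\<Sum>i=1..2*n. a i + b i)}" by auto
  next
    fix M assume M: "M \<in> idx n" and k: "k = wt n M"
    define a where "a = (\<lambda>i. if M i \<ge> 0 then nat (M i) else nat (- M i) - 1)"
    define b where "b = (\<lambda>i. if M i \<ge> 0 then 0 else 1 :: nat)"
    have "trig_monomial n M = z n a b"
      by (auto simp: trig_monomial_def z_def sep_def prod.distrib[symmetric] fun_eq_iff a_def b_def trig_mono_def
          intro!: prod.cong)
    moreover have "(\<Sum>i=1..2*n. a i + b i) = wt n M"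
      unfolding wt_def by (rule sum.cong) (auto simp: a_def b_def)
    ultimately show "\<exists>a b. trig_monomial n M = z n a b \<and> (\<Sum>i=1..2*n. a i + b i) = wt n M \<and> (\<forall>i\<in>{1..2*n}. b i \<in> {0, 1})"
      by (intro exI[of _ a] exI[of _ b]) (auto simp: b_def)
  qed
  then show ?thesis by (simp add: V_def)
qed

text \<open>Here only the spans agree: generators with higher powers of cos have to be reduced,
  which raises the degree in no variable.\<close>

lemma W_eq_span_trig_monomial: "W n k = span (trig_monomial n ` {M\<in>idx n. wt n M \<le> k})"
proof
  show "W n k \<subseteq> span (trig_monomial n ` {M\<in>idx n. wt n M \<le> k})"
    unfolding W_def
  proof (rule span_minimal, safe)
    fix a b :: "nat \<Rightarrow> nat"
    assume k: "(\<Sum>i=1..2*n. a i + b i) \<le> k"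
    have "z n a b = sep {1..2*n} (\<lambda>i t. sin t ^ a i * cos t ^ b i)"
      by (simp add: z_def sep_def prod.distrib)
    also have "\<dots> \<in> span (trig_monomial n ` {M\<in>idx n. \<forall>i\<in>{1..2*n}. nat \<bar>M i\<bar> \<le> a i + b i})"
      by (intro sep_in_span_trig_monomial sin_cos_power_in_trig_space) simp
    also have "\<dots> \<subseteq> span (trig_monomial n ` {M\<in>idx n. wt n M \<le> k})"
    proof (intro span_mono image_mono, safe)
      fix M assume "\<forall>i\<in>{1..2*n}. nat \<bar>M i\<bar> \<le> a i + b i"
      then have "wt n M \<le> (\<Sum>i=1..2*n. a i + b i)"
        unfolding wt_def by (intro sum_mono) auto
      then show "wt n M \<le> k" using k by simp
    qed
    finally show "z n a b \<in> span (trig_monomial n ` {M\<in>idx n. wt n M \<le> k})" .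
  qed
  have "trig_monomial n M \<in> W n k" if "M \<in> idx n" "wt n M \<le> k" for M
  proof -
    have "trig_monomial n M \<in> V n (wt n M)"
      unfolding V_eq_span_trig_monomial using that by (intro span_base) auto
    also have "\<dots> \<subseteq> W n k"
      unfolding V_def W_def
    proof (rule span_mono, rule subsetI)
      fix F
      assume "F \<in> {z n a b | a b. (\<Sum>i=1..2*n. a i + b i) = wt n M \<and> (\<forall>i\<in>{1..2*n}. b i \<in> {0, 1})}"
      then obtain a b where "F = z n a b" "(\<Sum>i=1..2*n. a i + b i) = wt n M" by blast
      with that(2) show "F \<in> {z n a b | a b. (\<Sum>i=1..2*n. a i + b i) \<le> k}"
        by (metis (mono_tags, lifting) mem_Collect_eq)
    qed
    finally show ?thesis .
  qed
  then show "span (trig_monomial n ` {M\<in>idx n. wt n M \<le> k}) \<subseteq> W n k"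
    by (intro span_minimal) (auto simp: W_def)
qed

text \<open>The strict bound absorbs the convention at \<open>k = 0\<close>: no index has negative
  weight, and the span of the empty set is zero.\<close>

lemma W_pred_eq_span_trig_monomial: "W_pred n k = span (trig_monomial n ` {M\<in>idx n. wt n M < k})"
proof (cases k)
  case (Suc l)
  have "{M\<in>idx n. wt n M < k} = {M\<in>idx n. wt n M \<le> l}" using Suc by auto
  then show ?thesis using Suc by (simp add: W_pred_def W_eq_span_trig_monomial)
qed (simp add: W_pred_def)

subsection \<open>Homogeneous components\<close>

definition trig_poly :: "nat \<Rightarrow> tfun set" where
  "trig_poly n = span (trig_monomial n ` idx n)"

text \<open>One linear map on the whole function space, obtained by extension from the basis. It
  replaces the definite descriptions in \<open>top_part\<close> and \<open>components\<close>, and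
  its linearity carries no side condition.\<close>

definition proj :: "nat \<Rightarrow> nat \<Rightarrow> tfun \<Rightarrow> tfun" where
  "proj n k = construct (trig_monomial n ` idx n)
     (\<lambda>F. if F \<in> trig_monomial n ` {M\<in>idx n. wt n M = k} then F else 0)"

lemma linear_proj: "linear (proj n k)"
  unfolding proj_def by (rule linear_construct[OF independent_trig_monomial])

lemma proj_trig_monomial:
  assumes "M \<in> idx n"
  shows "proj n k (trig_monomial n M) = (if wt n M = k then trig_monomial n M else 0)"
proof -
  have "trig_monomial n M \<in> trig_monomial n ` {M\<in>idx n. wt n M = k} \<longleftrightarrow> wt n M = k"
    using inj_on_image_mem_iff[OF inj_on_trig_monomial assms, of "{M\<in>idx n. wt n M = k}"] assms by auto
  then show ?thesis
    unfolding proj_def using assms by (simp add: construct_basis[OF independent_trig_monomial])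
qed

lemma V_subset_trig_poly: "V n k \<subseteq> trig_poly n"
  unfolding V_eq_span_trig_monomial trig_poly_def by (intro span_mono) auto

lemma W_subset_trig_poly: "W n k \<subseteq> trig_poly n"
  unfolding W_eq_span_trig_monomial trig_poly_def by (intro span_mono) auto

lemma V_subset_W: "j \<le> k \<Longrightarrow> V n j \<subseteq> W n k"
  unfolding V_eq_span_trig_monomial W_eq_span_trig_monomial by (intro span_mono) auto

lemma W_mono: "j \<le> k \<Longrightarrow> W n j \<subseteq> W n k"
  unfolding W_eq_span_trig_monomial by (intro span_mono) auto

lemma V_pos_subset_trig_poly: "V_pos n \<subseteq> trig_poly n"
  unfolding V_pos_def
  by (rule span_minimal) (use V_subset_trig_poly in \<open>auto simp: trig_poly_def\<close>)

lemma proj_V: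
  assumes "F \<in> V n j"
  shows "proj n k F = (if j = k then F else 0)"
proof -
  \<comment> \<open>Written with a scalar, the right side is linear in \<open>F\<close>, so
    agreement on the basis suffices.\<close>
  have "proj n k F = (if j = k then 1 else 0) *\<^sub>R F"
    using assms unfolding V_eq_span_trig_monomial
    by (rule linear_eq_on_span[OF linear_proj linear_scale_self, rotated])
      (auto simp: proj_trig_monomial)
  then show ?thesis by auto
qed

lemma proj_W_high:
  assumes "F \<in> W n k" "k < j"
  shows "proj n j F = 0"
proof -
  have "proj n j F = (\<lambda>_. 0) F"
    using assms(1) unfolding W_eq_span_trig_monomial
    by (rule linear_eq_on_span[OF linear_proj module_hom_zero, rotated])
      (use assms(2) in \<open>auto simp: proj_trig_monomial\<close>)
  then show ?thesis .
qed

lemma proj_W_pred: "F \<in> W_pred n k \<Longrightarrow> proj n k F = 0"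
  using proj_W_high[of F n "k - 1" k]
  by (auto simp: W_pred_def linear_0[OF linear_proj] split: if_splits)

lemma proj_in_V:
  assumes "F \<in> trig_poly n"
  shows "proj n k F \<in> V n k"
  using assms unfolding V_eq_span_trig_monomial trig_poly_def
  by (rule linear_in_span[OF linear_proj, rotated])
    (auto simp: proj_trig_monomial intro!: span_zero span_base[OF imageI])

lemma diff_proj_in_W_pred:
  assumes "F \<in> W n k"
  shows "F - proj n k F \<in> W_pred n k"
  using assms unfolding W_pred_eq_span_trig_monomial W_eq_span_trig_monomial
proof (rule linear_in_span[rotated 2])
  show "linear (\<lambda>F. F - proj n k F)"
    using linear_compose_sub[OF linear_id[unfolded id_def] linear_proj] .
next
  fix G assume "G \<in> trig_monomial n ` {M\<in>idx n. wt n M \<le> k}"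
  then obtain M where M: "G = trig_monomial n M" "M \<in> idx n" "wt n M \<le> k" by blast
  show "G - proj n k G \<in> span (trig_monomial n ` {M\<in>idx n. wt n M < k})"
  proof (cases "wt n M = k")
    case True
    then show ?thesis using M span_zero by (simp add: proj_trig_monomial)
  next
    case False
    then show ?thesis using M by (auto simp: proj_trig_monomial intro!: span_base imageI)
  qed
qed

text \<open>Uniqueness holds because \<open>proj n k\<close> fixes \<open>V n k\<close> and kills
  \<open>W_pred n k\<close>.\<close>

lemma top_part_eq_proj:
  assumes "F \<in> W n k"
  shows "top_part n k F = proj n k F"
  unfolding top_part_def
proof (rule the_equality)
  show "proj n k F \<in> V n k \<and> F - proj n k F \<in> W_pred n k"
    using assms proj_in_V W_subset_trig_poly diff_proj_in_W_pred by blast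
next
  fix H assume H: "H \<in> V n k \<and> F - H \<in> W_pred n k"
  then have "proj n k (F - H) = 0" by (intro proj_W_pred) simp
  then show "H = proj n k F"
    using H proj_V[of H n k k] by (simp add: linear_diff[OF linear_proj])
qed

lemma trig_poly_in_W:
  assumes "F \<in> trig_poly n"
  shows "\<exists>k. F \<in> W n k"
  using assms unfolding trig_poly_def
proof (rule span_induct_linear[where P = "\<lambda>F. \<exists>k. F \<in> W n k"])
  fix F assume "F \<in> trig_monomial n ` idx n"
  then show "\<exists>k. F \<in> W n k" by (auto simp: W_eq_span_trig_monomial intro!: span_base)
next
  show "\<exists>k. 0 \<in> W n k" by (auto simp: W_def span_zero)
next
  fix F G assume "\<exists>k. F \<in> W n k" "\<exists>k. G \<in> W n k"
  then obtain k l where "F \<in> W n k" "G \<in> W n l" by blast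
  then have "F \<in> W n (max k l)" "G \<in> W n (max k l)"
    using W_mono[of k "max k l"] W_mono[of l "max k l"] by auto
  then show "\<exists>k. F + G \<in> W n k" unfolding W_def by (blast intro: span_add)
next
  fix c F assume "\<exists>k. F \<in> W n k"
  then show "\<exists>k. c *\<^sub>R F \<in> W n k" unfolding W_def by (blast intro: span_scale)
qed

lemma sum_proj:
  assumes "F \<in> W n k"
  shows "(\<Sum>j\<le>k. proj n j F) = F"
proof -
  have "(\<Sum>j\<le>k. proj n j F) = id F"
    using assms unfolding W_eq_span_trig_monomial
  proof (rule linear_eq_on_span[rotated 3])
    show "linear (\<lambda>F. \<Sum>j\<le>k. proj n j F)"
      by (rule linear_compose_sum) (simp add: linear_proj)
    show "linear (id :: tfun \<Rightarrow> tfun)" by (rule linear_id)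
  qed (auto simp: proj_trig_monomial sum.delta)
  then show ?thesis by simp
qed

text \<open>Applying \<open>proj n j\<close> to any admissible decomposition isolates its member of
  weight \<open>j\<close>, which gives uniqueness.\<close>

lemma components_eq_proj:
  assumes "F \<in> trig_poly n"
  shows "components n F = (\<lambda>j. proj n j F)"
  unfolding components_def
proof (rule the_equality)
  obtain k where k: "F \<in> W n k" using trig_poly_in_W[OF assms] by blast
  have sub: "{j. proj n j F \<noteq> 0} \<subseteq> {..k}"
    using proj_W_high[OF k] by (auto simp: not_le[symmetric])
  moreover have "F = (\<Sum>j | proj n j F \<noteq> 0. proj n j F)"
    by (subst sum.mono_neutral_left[OF _ sub]) (auto simp: sum_proj[OF k])
  ultimately show "(\<forall>j. proj n j F \<in> V n j) \<and> finite {j. proj n j F \<noteq> 0} \<and>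
      F = (\<Sum>j | proj n j F \<noteq> 0. proj n j F)"
    using finite_subset proj_in_V[OF assms] by auto
next
  fix c assume c: "(\<forall>j. c j \<in> V n j) \<and> finite {j. c j \<noteq> 0} \<and> F = (\<Sum>j | c j \<noteq> 0. c j)"
  show "c = (\<lambda>j. proj n j F)"
  proof
    fix j
    have "proj n j F = (\<Sum>i | c i \<noteq> 0. proj n j (c i))"
      using c by (metis linear_sum[OF linear_proj])
    also have "\<dots> = (\<Sum>i | c i \<noteq> 0. if i = j then c i else 0)"
      using c by (intro sum.cong) (auto simp: proj_V)
    also have "\<dots> = c j" using c by (subst sum.delta) auto
    finally show "c j = proj n j F" by simp
  qed
qed

subsection \<open>The Poisson bracket of homogeneous elements\<close>

text \<open>Existence of all partial derivatives, the condition under which \<open>partial\<close>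
  is additive.\<close>

definition coord_diff :: "tfun \<Rightarrow> bool" where
  "coord_diff F \<longleftrightarrow> (\<forall>i x. (\<lambda>t. F (x(i := t))) field_differentiable at (x i))"

lemma coord_diff_zero: "coord_diff 0"
  by (simp add: coord_diff_def)

lemma coord_diff_add: "coord_diff F \<Longrightarrow> coord_diff G \<Longrightarrow> coord_diff (F + G)"
  by (simp add: coord_diff_def field_differentiable_add)

lemma coord_diff_scale: "coord_diff F \<Longrightarrow> coord_diff (c *\<^sub>R F)"
  by (auto simp: coord_diff_def intro!: field_differentiable_mult)

lemma partial_zero: "partial i 0 = 0"
  by (simp add: partial_def fun_eq_iff)

lemma partial_add: "coord_diff F \<Longrightarrow> coord_diff G \<Longrightarrow> partial i (F + G) = partial i F + partial i G"
  by (auto simp: coord_diff_def partial_def fun_eq_iff)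

lemma partial_scale: "coord_diff F \<Longrightarrow> partial i (c *\<^sub>R F) = c *\<^sub>R partial i F"
  by (auto simp: coord_diff_def partial_def fun_eq_iff)

lemma sep_has_derivative:
  assumes "finite S" "i \<in> S" "\<And>t. (h i has_field_derivative h' t) (at t)"
  shows "((\<lambda>t. sep S h (x(i := t))) has_field_derivative sep S (h(i := h')) x) (at (x i))"
proof -
  have eq: "sep S h (x(i := t)) = h i t * (\<Prod>k\<in>S - {i}. h k (x k))" for t
    unfolding sep_def using assms(1,2)
    by (subst prod.remove[of S i]) (auto intro!: arg_cong2[where f="(*)"] prod.cong)
  have "sep S (h(i := h')) x = h' (x i) * (\<Prod>k\<in>S - {i}. h k (x k))"
    unfolding sep_def using assms(1,2)
    by (subst prod.remove[of S i]) (auto intro!: arg_cong2[where f="(*)"] prod.cong)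
  then show ?thesis
    unfolding eq using assms(3)[of "x i"] by (auto intro!: derivative_eq_intros)
qed

lemma partial_trig_monomial:
  assumes "i \<in> {1..2*n}"
  shows "partial i (trig_monomial n M)
    = sep {1..2*n} ((\<lambda>k. trig_mono (M k))(i := trig_mono_deriv (M i)))"
proof
  fix x
  show "partial i (trig_monomial n M) x
    = sep {1..2*n} ((\<lambda>k. trig_mono (M k))(i := trig_mono_deriv (M i))) x"
    unfolding partial_def trig_monomial_def
    by (rule DERIV_imp_deriv, rule sep_has_derivative)
      (use assms has_field_derivative_trig_mono in auto)
qed

lemma partial_trig_monomial_zero:
  assumes "i \<in> {1..2*n}" "M i = 0"
  shows "partial i (trig_monomial n M) = 0"
  using assms linear_0[OF sep_update_linear[OF finite_atLeastAtMost assms(1)]]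
  by (simp add: partial_trig_monomial)

lemma coord_diff_trig_poly:
  assumes "F \<in> trig_poly n"
  shows "coord_diff F"
  using assms unfolding trig_poly_def
proof (rule span_induct_linear[where P = coord_diff])
  fix F assume "F \<in> trig_monomial n ` idx n"
  then obtain M where M: "F = trig_monomial n M" by blast
  show "coord_diff F"
    unfolding coord_diff_def
  proof (intro allI)
    fix i x
    show "(\<lambda>t. F (x(i := t))) field_differentiable at (x i)"
    proof (cases "i \<in> {1..2*n}")
      case True
      then show ?thesis
        using sep_has_derivative[of "{1..2*n}" i "\<lambda>k. trig_mono (M k)"] has_field_derivative_trig_mono
        unfolding M trig_monomial_def field_differentiable_def by blast
    next
      case False
      then have "F (x(i := t)) = F x" for t
        unfolding M trig_monomial_def sep_def by (intro prod.cong) auto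
      then show ?thesis by simp
    qed
  qed
qed (auto intro: coord_diff_zero coord_diff_add coord_diff_scale)

lemma poisson_skew: "poisson n G F = - poisson n F G"
  unfolding poisson_def sum_negf[symmetric] by (rule sum.cong) (auto simp: algebra_simps)

lemma poisson_zero_left: "poisson n 0 G = 0"
  by (simp add: poisson_def partial_zero)

lemma poisson_zero_right: "poisson n F 0 = 0"
  by (simp add: poisson_skew[of n F 0] poisson_zero_left)

lemma poisson_add_left:
  "coord_diff F \<Longrightarrow> coord_diff F' \<Longrightarrow> poisson n (F + F') G = poisson n F G + poisson n F' G"
  unfolding poisson_def sum.distrib[symmetric]
  by (rule sum.cong) (auto simp: partial_add algebra_simps)

lemma poisson_scale_left: "coord_diff F \<Longrightarrow> poisson n (c *\<^sub>R F) G = c *\<^sub>R poisson n F G"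
  unfolding poisson_def scaleR_sum_right
  by (rule sum.cong) (auto simp: partial_scale algebra_simps fun_eq_iff)

lemma poisson_span_left:
  assumes "F \<in> span A" "A \<subseteq> trig_poly n" "\<And>F. F \<in> A \<Longrightarrow> poisson n F G \<in> span B"
  shows "poisson n F G \<in> span B"
proof -
  \<comment> \<open>Differentiability is carried through the induction, since additivity of
    \<open>poisson\<close> depends on it.\<close>
  have "coord_diff F \<and> poisson n F G \<in> span B"
    using assms(1)
    by (rule span_induct_linear[where P = "\<lambda>F. coord_diff F \<and> poisson n F G \<in> span B"])
      (use assms(2,3) in \<open>auto simp: coord_diff_trig_poly coord_diff_zero coord_diff_add coord_diff_scale
         poisson_zero_left poisson_add_left poisson_scale_left span_zero span_add span_scale\<close>)
  then show ?thesis ..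
qed

lemma poisson_span:
  assumes "F \<in> span A" "G \<in> span B" "A \<subseteq> trig_poly n" "B \<subseteq> trig_poly n"
    "\<And>F G. F \<in> A \<Longrightarrow> G \<in> B \<Longrightarrow> poisson n F G \<in> span C"
  shows "poisson n F G \<in> span C"
proof (rule poisson_span_left[OF assms(1,3)])
  fix F assume F: "F \<in> A"
  have "poisson n G F \<in> span C"
  proof (rule poisson_span_left[OF assms(2,4)])
    fix G assume "G \<in> B"
    then show "poisson n G F \<in> span C"
      using span_neg[OF assms(5)[OF F]] by (simp add: poisson_skew[of n G F])
  qed
  then show "poisson n F G \<in> span C"
    using span_neg by (simp add: poisson_skew[of n F G])
qed

section \<open>Brackets of monomials and their terms of top weight\<close>

definition mixed :: "nat \<Rightarrow> (nat \<Rightarrow> int) \<Rightarrow> bool" where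
  "mixed n M \<longleftrightarrow> (\<exists>j\<in>{1..n}. M (2*j - 1) \<noteq> 0 \<and> M (2*j) \<noteq> 0)"

text \<open>In variable \<open>i\<close> every term has degree at most the sum of those of
  \<open>P\<close> and \<open>Q\<close>. Full total weight forces equality in each variable, so
  \<open>P a\<close> and \<open>Q b\<close> being nonzero makes both entries of the pair nonzero. If
  one of them is zero, the product vanishes.\<close>

lemma partial_mult_partial_in_span:
  assumes "j \<in> {1..n}" "(a, b) = (2*j - 1, 2*j) \<or> (a, b) = (2*j, 2*j - 1)"
  shows "partial a (trig_monomial n P) * partial b (trig_monomial n Q)
    \<in> span (trig_monomial n ` {M\<in>idx n. wt n M < wt n P + wt n Q \<or> wt n M = wt n P + wt n Q \<and> mixed n M})"
proof (cases "P a = 0 \<or> Q b = 0")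
  case True
  have "a \<in> {1..2*n}" "b \<in> {1..2*n}" using assms by auto
  with True have "partial a (trig_monomial n P) = 0 \<or> partial b (trig_monomial n Q) = 0"
    by (auto simp: partial_trig_monomial_zero)
  then show ?thesis by (auto simp: span_zero)
next
  case False
  have ab: "a \<in> {1..2*n}" "b \<in> {1..2*n}" using assms by auto
  let ?d = "\<lambda>i. nat \<bar>P i\<bar> + nat \<bar>Q i\<bar>"
  have "partial a (trig_monomial n P) * partial b (trig_monomial n Q)
      \<in> span (trig_monomial n ` {M\<in>idx n. \<forall>i\<in>{1..2*n}. nat \<bar>M i\<bar> \<le> ?d i})"
    unfolding partial_trig_monomial[OF ab(1)] partial_trig_monomial[OF ab(2)] sep_mult
    by (intro sep_in_span_trig_monomial trig_space_mult)
      (auto simp: trig_mono_deriv_in_trig_space trig_mono_in_trig_space)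
  also have "\<dots> \<subseteq> span (trig_monomial n ` {M\<in>idx n. wt n M < wt n P + wt n Q \<or> wt n M = wt n P + wt n Q \<and> mixed n M})"
  proof (intro span_mono image_mono subsetI)
    fix M assume "M \<in> {M\<in>idx n. \<forall>i\<in>{1..2*n}. nat \<bar>M i\<bar> \<le> ?d i}"
    then have M: "M \<in> idx n" "\<And>i. i \<in> {1..2*n} \<Longrightarrow> nat \<bar>M i\<bar> \<le> ?d i" by auto
    have sum: "wt n P + wt n Q = (\<Sum>i=1..2*n. ?d i)"
      by (simp add: wt_def sum.distrib)
    have le: "wt n M \<le> wt n P + wt n Q"
      unfolding sum unfolding wt_def by (rule sum_mono) (rule M(2))
    have "mixed n M" if eq: "wt n M = wt n P + wt n Q"
    proof -
      have "nat \<bar>M i\<bar> = ?d i" if "i \<in> {1..2*n}" for i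
        by (rule sum_mono_inv[OF eq[unfolded sum, unfolded wt_def] M(2) that]) simp_all
      then have "M a \<noteq> 0" "M b \<noteq> 0" using False ab by fastforce+
      then show ?thesis unfolding mixed_def using assms by auto
    qed
    with le M(1) show "M \<in> {M\<in>idx n. wt n M < wt n P + wt n Q \<or> wt n M = wt n P + wt n Q \<and> mixed n M}"
      by auto
  qed
  finally show ?thesis .
qed

lemma poisson_V_in_span:
  assumes "F \<in> V n f" "G \<in> V n g"
  shows "poisson n F G
    \<in> span (trig_monomial n ` {M\<in>idx n. wt n M < f + g \<or> wt n M = f + g \<and> mixed n M})"
  using assms unfolding V_eq_span_trig_monomial
proof (rule poisson_span)
  fix F G
  assume "F \<in> trig_monomial n ` {M\<in>idx n. wt n M = f}" "G \<in> trig_monomial n ` {M\<in>idx n. wt n M = g}"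
  then obtain P Q where PQ: "F = trig_monomial n P" "G = trig_monomial n Q" "wt n P = f" "wt n Q = g"
    by blast
  show "poisson n F G
    \<in> span (trig_monomial n ` {M\<in>idx n. wt n M < f + g \<or> wt n M = f + g \<and> mixed n M})"
    unfolding poisson_def PQ(1,2) PQ(3,4)[symmetric]
    by (intro span_sum span_diff partial_mult_partial_in_span) auto
qed (auto simp: trig_poly_def intro: span_base)

lemma poisson_V_in_W:
  assumes "F \<in> V n f" "G \<in> V n g"
  shows "poisson n F G \<in> W n (f + g)"
proof -
  note poisson_V_in_span[OF assms]
  also have "span (trig_monomial n ` {M\<in>idx n. wt n M < f + g \<or> wt n M = f + g \<and> mixed n M}) \<subseteq> W n (f + g)"
    unfolding W_eq_span_trig_monomial by (intro span_mono) auto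
  finally show ?thesis .
qed

lemma proj_poisson_in_span_mixed:
  assumes "F \<in> V n f" "G \<in> V n g"
  shows "proj n (f + g) (poisson n F G)
    \<in> span (trig_monomial n ` {M\<in>idx n. wt n M = f + g \<and> mixed n M})"
  using poisson_V_in_span[OF assms]
  by (rule linear_in_span[OF linear_proj, rotated])
    (auto simp: proj_trig_monomial intro!: span_zero span_base[OF imageI])

text \<open>The definition sums over the supports of the components, which change with
  \<open>F\<close> and \<open>G\<close>. A common range \<open>{..N}\<close> allows brackets of
  different arguments to be compared term by term.\<close>

lemma bracket_top_eq_sum:
  assumes "F \<in> W n N" "G \<in> W n N"
  shows "bracket_top n F G
    = (\<Sum>f\<le>N. \<Sum>g\<le>N. proj n (f + g) (poisson n (proj n f F) (proj n g G)))"
proof -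
  have FG: "F \<in> trig_poly n" "G \<in> trig_poly n"
    using assms W_subset_trig_poly by auto
  have sub: "{f. proj n f F \<noteq> 0} \<subseteq> {..N}" "{g. proj n g G \<noteq> 0} \<subseteq> {..N}"
    using proj_W_high[OF assms(1)] proj_W_high[OF assms(2)] by (auto simp: not_le[symmetric])
  have "bracket_top n F G = (\<Sum>f | proj n f F \<noteq> 0. \<Sum>g | proj n g G \<noteq> 0.
      proj n (f + g) (poisson n (proj n f F) (proj n g G)))"
    unfolding bracket_top_def components_eq_proj[OF FG(1)] components_eq_proj[OF FG(2)]
    by (intro sum.cong refl top_part_eq_proj poisson_V_in_W proj_in_V FG)
  also have "\<dots> = (\<Sum>f | proj n f F \<noteq> 0. \<Sum>g\<le>N.
      proj n (f + g) (poisson n (proj n f F) (proj n g G)))"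
    by (intro sum.cong refl sum.mono_neutral_left sub)
      (auto simp: poisson_zero_right linear_0[OF linear_proj])
  also have "\<dots> = (\<Sum>f\<le>N. \<Sum>g\<le>N. proj n (f + g) (poisson n (proj n f F) (proj n g G)))"
    by (intro sum.mono_neutral_left sub)
      (auto simp: poisson_zero_left linear_0[OF linear_proj] intro!: sum.neutral)
  finally show ?thesis .
qed

lemma bracket_top_V:
  assumes "F \<in> V n f" "G \<in> V n g"
  shows "bracket_top n F G = proj n (f + g) (poisson n F G)"
proof -
  have N: "F \<in> W n (max f g)" "G \<in> W n (max f g)"
    using assms V_subset_W[of f "max f g"] V_subset_W[of g "max f g"] by auto
  have "bracket_top n F G = (\<Sum>f'\<le>max f g. \<Sum>g'\<le>max f g.
      if g' = g then if f' = f then proj n (f + g) (poisson n F G) else 0 else 0)"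
    unfolding bracket_top_eq_sum[OF N]
    by (intro sum.cong refl)
      (auto simp: proj_V[OF assms(1)] proj_V[OF assms(2)] poisson_zero_right poisson_zero_left linear_0[OF linear_proj])
  also have "\<dots> = proj n (f + g) (poisson n F G)"
    by (simp add: sum.delta)
  finally show ?thesis .
qed

section \<open>Skew symmetry and bilinearity of the top bracket\<close>

lemma common_W:
  assumes "F \<in> trig_poly n" "G \<in> trig_poly n" "H \<in> trig_poly n"
  obtains k where "F \<in> W n k" "G \<in> W n k" "H \<in> W n k"
proof -
  obtain a b c where "F \<in> W n a" "G \<in> W n b" "H \<in> W n c"
    using trig_poly_in_W assms by meson
  then show ?thesis
    using W_mono[of a "a + b + c" n] W_mono[of b "a + b + c" n] W_mono[of c "a + b + c" n]
    by (intro that[of "a + b + c"]) auto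
qed

lemma bracket_top_skew:
  assumes "F \<in> trig_poly n" "G \<in> trig_poly n"
  shows "bracket_top n G F = - bracket_top n F G"
proof -
  obtain k where k: "F \<in> W n k" "G \<in> W n k"
    using common_W[OF assms assms(1)] by blast
  have "bracket_top n G F = (\<Sum>f\<le>k. \<Sum>g\<le>k. proj n (g + f) (poisson n (proj n g G) (proj n f F)))"
    unfolding bracket_top_eq_sum[OF k(2,1)] by (rule sum.swap)
  also have "\<dots> = (\<Sum>f\<le>k. \<Sum>g\<le>k. - proj n (f + g) (poisson n (proj n f F) (proj n g G)))"
    by (intro sum.cong refl, subst poisson_skew) (simp add: linear_neg[OF linear_proj] add.commute)
  finally show ?thesis
    unfolding bracket_top_eq_sum[OF k] by (simp add: sum_negf)
qed

lemma bracket_top_self: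
  assumes "F \<in> trig_poly n"
  shows "bracket_top n F F = 0"
proof -
  have "bracket_top n F F x = 0" for x
    using fun_cong[OF bracket_top_skew[OF assms assms], of x] by simp
  then show ?thesis by (simp add: fun_eq_iff)
qed

lemma bracket_top_add_left:
  assumes "F \<in> trig_poly n" "F' \<in> trig_poly n" "G \<in> trig_poly n"
  shows "bracket_top n (F + F') G = bracket_top n F G + bracket_top n F' G"
proof -
  obtain k where k: "F \<in> W n k" "F' \<in> W n k" "G \<in> W n k"
    using common_W[OF assms] by blast
  then have k': "F + F' \<in> W n k" unfolding W_def by (intro span_add)
  have "coord_diff (proj n f F)" "coord_diff (proj n f F')" for f
    using proj_in_V V_subset_trig_poly assms by (blast intro: coord_diff_trig_poly)+
  then show ?thesis
    unfolding bracket_top_eq_sum[OF k(1,3)] bracket_top_eq_sum[OF k(2,3)] bracket_top_eq_sum[OF k' k(3)]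
    by (simp add: linear_add[OF linear_proj] poisson_add_left sum.distrib)
qed

lemma bracket_top_scale_left:
  assumes "F \<in> trig_poly n" "G \<in> trig_poly n"
  shows "bracket_top n (c *\<^sub>R F) G = c *\<^sub>R bracket_top n F G"
proof -
  obtain k where k: "F \<in> W n k" "G \<in> W n k"
    using common_W[OF assms assms(1)] by blast
  then have k': "c *\<^sub>R F \<in> W n k" unfolding W_def by (intro span_scale)
  have "coord_diff (proj n f F)" for f
    using proj_in_V V_subset_trig_poly assms by (blast intro: coord_diff_trig_poly)+
  then show ?thesis
    unfolding bracket_top_eq_sum[OF k] bracket_top_eq_sum[OF k' k(2)]
    by (simp add: linear_scale[OF linear_proj] poisson_scale_left scaleR_sum_right)
qed

lemma trig_poly_add: "F \<in> trig_poly n \<Longrightarrow> G \<in> trig_poly n \<Longrightarrow> F + G \<in> trig_poly n"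
  unfolding trig_poly_def by (rule span_add)

lemma trig_poly_scale: "F \<in> trig_poly n \<Longrightarrow> c *\<^sub>R F \<in> trig_poly n"
  unfolding trig_poly_def by (rule span_scale)

lemma bracket_top_add_right:
  assumes "F \<in> trig_poly n" "G \<in> trig_poly n" "G' \<in> trig_poly n"
  shows "bracket_top n F (G + G') = bracket_top n F G + bracket_top n F G'"
  using assms by (simp add: bracket_top_skew[of _ n F] trig_poly_add bracket_top_add_left)

lemma bracket_top_scale_right:
  assumes "F \<in> trig_poly n" "G \<in> trig_poly n"
  shows "bracket_top n F (c *\<^sub>R G) = c *\<^sub>R bracket_top n F G"
  using assms by (simp add: bracket_top_skew[of _ n F] trig_poly_scale bracket_top_scale_left)

text \<open>Bracket \<open>sin\<close> or \<open>cos\<close> of \<open>x (2*j - 1)\<close> with the monomial obtained from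
  \<open>M\<close> by lowering the degree in that variable by one and exchanging the two monomials of the
  given degree in \<open>x (2*j)\<close>.\<close>

lemma trig_monomial_mixed_as_bracket:
  assumes M: "M \<in> idx n" and "mixed n M"
  obtains F G c where "F \<in> V n 1" "G \<in> V n (wt n M - 1)" "wt n M \<ge> 2" "c \<noteq> 0"
    "bracket_top n F G = c *\<^sub>R trig_monomial n M"
proof -
  obtain j where j: "j \<in> {1..n}" "M (2*j - 1) \<noteq> 0" "M (2*j) \<noteq> 0"
    using assms(2) unfolding mixed_def by blast
  define S a b where "S = {1..2*n}" and "a = 2*j - 1" and "b = 2*j"
  have ab: "a \<in> S" "b \<in> S" "a \<noteq> b" "M a \<noteq> 0" "M b \<noteq> 0" and S: "finite S"
    using j by (auto simp: S_def a_def b_def)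
  define s where "s = sgn (M a)"
  have s: "s = 1 \<or> s = -1" using ab(4) by (auto simp: s_def sgn_if)
  \<comment> \<open>\<open>F\<close> is cos of variable \<open>a\<close> if \<open>M a > 0\<close>
    and sin otherwise, so that its derivative is a multiple of the monomial of degree one with the
    sign of \<open>M a\<close>.\<close>
  define P where "P = (\<lambda>_. 0)(a := - s)"
  \<comment> \<open>The entry at \<open>a\<close> is nonnegative, a pure power of sin, so
    multiplying by the derivative of \<open>F\<close> gives a multiple of
    \<open>trig_mono (M a)\<close> with no error. The entry \<open>- M b\<close> is turned back into
    \<open>M b\<close> by differentiation.\<close>
  define Q where "Q = M(a := \<bar>M a\<bar> - 1, b := - M b)"
  have idx: "P \<in> idx n" "Q \<in> idx n"
    using M ab by (auto simp: idx_def P_def Q_def S_def)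
  have wt_split: "wt n N = nat \<bar>N a\<bar> + (nat \<bar>N b\<bar> + (\<Sum>i\<in>S - {a} - {b}. nat \<bar>N i\<bar>))" for N
    unfolding wt_def S_def[symmetric] using S ab(1-3)
    by (subst sum.remove[of S a], simp, simp, subst sum.remove[of "S - {a}" b]) auto
  have rest: "(\<Sum>i\<in>S - {a} - {b}. nat \<bar>P i\<bar>) = 0"
    "(\<Sum>i\<in>S - {a} - {b}. nat \<bar>Q i\<bar>) = (\<Sum>i\<in>S - {a} - {b}. nat \<bar>M i\<bar>)"
    by (auto simp: P_def Q_def intro!: sum.neutral sum.cong)
  have wt: "wt n P = 1" "wt n Q = wt n M - 1" "wt n M \<ge> 2"
    using s ab unfolding wt_split[of P] wt_split[of Q] wt_split[of M] rest by (auto simp: P_def Q_def)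
  define F G where "F = trig_monomial n P" and "G = trig_monomial n Q"
  have V: "F \<in> V n 1" "G \<in> V n (wt n M - 1)"
    unfolding F_def G_def V_eq_span_trig_monomial using idx wt by (auto intro!: span_base imageI)
  let ?h = "\<lambda>k. trig_mono (M k)"
  \<comment> \<open>The only error term: the part of lower degree in the derivative in variable
    \<open>b\<close>.\<close>
  define r where "r = trig_mono_deriv (- M b) - of_int (- M b) *\<^sub>R trig_mono (M b)"
  have r: "r \<in> trig_space (nat \<bar>M b\<bar> - 1)"
    using trig_mono_deriv_lower[of "- M b"] ab by (simp add: r_def)
  have dF: "partial i F = 0" if "i \<in> S" "i \<noteq> a" for i
    unfolding F_def using that by (intro partial_trig_monomial_zero) (auto simp: P_def S_def)
  \<comment> \<open>\<open>F\<close> depends on variable \<open>a\<close> alone, so only one product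
    of the bracket survives.\<close>
  have "poisson n F G = (\<Sum>i\<in>{1..n}. if i = j then partial a F * partial b G else 0)"
    unfolding poisson_def
  proof (rule sum.cong[OF refl])
    fix i assume i: "i \<in> {1..n}"
    have "2 * i \<noteq> a" "2 * i \<in> S" using i j by (auto simp: a_def S_def, presburger)
    then have 1: "partial (2 * i) F = 0" by (intro dF)
    show "partial (2*i-1) F * partial (2*i) G - partial (2*i) F * partial (2*i-1) G
      = (if i = j then partial a F * partial b G else 0)"
    proof (cases "i = j")
      case True
      then show ?thesis using 1 by (simp add: a_def b_def)
    next
      case False
      have "2 * i - 1 \<noteq> a" "2 * i - 1 \<in> S" using i j False by (auto simp: a_def S_def)
      then have "partial (2 * i - 1) F = 0" by (intro dF)
      then show ?thesis using 1 False by simp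
    qed
  qed
  also have "\<dots> = partial a F * partial b G" using j(1) by simp
  also have "\<dots> = sep S (\<lambda>k. ((\<lambda>k. trig_mono (P k))(a := trig_mono_deriv (P a))) k
      * ((\<lambda>k. trig_mono (Q k))(b := trig_mono_deriv (Q b))) k)"
    unfolding F_def G_def using ab by (simp add: partial_trig_monomial S_def sep_mult)
  also have "\<dots> = sep S ((?h(b := trig_mono_deriv (- M b)))(a := of_int (- s) *\<^sub>R ?h a))"
  proof (rule sep_cong)
    fix k assume "k \<in> S"
    have "trig_mono_deriv (- s) * trig_mono (\<bar>M a\<bar> - 1) = of_int (- s) *\<^sub>R trig_mono (M a)"
    proof (cases "M a > 0")
      case True
      then show ?thesis
        by (simp add: s_def trig_mono_deriv_def trig_mono_def fun_eq_iff nat_diff_distrib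
            power_eq_if[of _ "nat (M a)"])
    next
      case False
      then show ?thesis using ab(4)
        by (simp add: s_def trig_mono_deriv_def trig_mono_def fun_eq_iff nat_diff_distrib)
    qed
    then show "((\<lambda>k. trig_mono (P k))(a := trig_mono_deriv (P a))) k
      * ((\<lambda>k. trig_mono (Q k))(b := trig_mono_deriv (Q b))) k
      = ((?h(b := trig_mono_deriv (- M b)))(a := of_int (- s) *\<^sub>R ?h a)) k"
      using ab by (auto simp: P_def Q_def fun_eq_iff)
  qed
  also have "\<dots> = of_int (- s) *\<^sub>R sep S ((?h(b := trig_mono_deriv (- M b)))(a := ?h a))"
    by (rule linear_scale[OF sep_update_linear[OF S ab(1)]])
  also have "(?h(b := trig_mono_deriv (- M b)))(a := ?h a)
      = ?h(b := of_int (- M b) *\<^sub>R ?h b + r)"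
    using ab by (auto simp: r_def fun_eq_iff)
  also have "sep S \<dots> = of_int (- M b) *\<^sub>R sep S ?h + sep S (?h(b := r))"
    using linear_add[OF sep_update_linear[OF S ab(2)], of ?h "of_int (- M b) *\<^sub>R ?h b" r]
      linear_scale[OF sep_update_linear[OF S ab(2)], of ?h "of_int (- M b)" "?h b"]
      fun_upd_triv[of ?h b] by simp
  finally have poisson: "poisson n F G = of_int (s * M b) *\<^sub>R trig_monomial n M
      + of_int (- s) *\<^sub>R sep S (?h(b := r))"
    by (simp add: fun_eq_iff algebra_simps trig_monomial_def S_def)
  \<comment> \<open>The degree in variable \<open>b\<close> has dropped and no other degree has
    risen, so the error has lower weight and the projection removes it.\<close>
  have "sep S (?h(b := r)) \<in> span (trig_monomial n `
      {N\<in>idx n. \<forall>i\<in>{1..2*n}. nat \<bar>N i\<bar> \<le> (if i = b then nat \<bar>M b\<bar> - 1 else nat \<bar>M i\<bar>)})"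
    unfolding S_def by (rule sep_in_span_trig_monomial) (use r in \<open>auto intro: trig_mono_in_trig_space\<close>)
  also have "\<dots> \<subseteq> W_pred n (wt n M)"
    unfolding W_pred_eq_span_trig_monomial
  proof (intro span_mono image_mono subsetI)
    fix N assume "N \<in> {N\<in>idx n. \<forall>i\<in>{1..2*n}. nat \<bar>N i\<bar> \<le> (if i = b then nat \<bar>M b\<bar> - 1 else nat \<bar>M i\<bar>)}"
    then have N: "N \<in> idx n"
      "\<And>i. i \<in> S \<Longrightarrow> nat \<bar>N i\<bar> \<le> (if i = b then nat \<bar>M b\<bar> - 1 else nat \<bar>M i\<bar>)"
      by (auto simp: S_def)
    have "wt n N < wt n M"
      unfolding wt_def S_def[symmetric]
    proof (rule sum_strict_mono_ex1[OF S])
      show "\<forall>i\<in>S. nat \<bar>N i\<bar> \<le> nat \<bar>M i\<bar>"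
      proof
        fix i assume "i \<in> S"
        then show "nat \<bar>N i\<bar> \<le> nat \<bar>M i\<bar>" using N(2)[of i] by (auto split: if_splits)
      qed
      have "nat \<bar>N b\<bar> < nat \<bar>M b\<bar>" using N(2)[OF ab(2)] ab(5) by simp
      then show "\<exists>i\<in>S. nat \<bar>N i\<bar> < nat \<bar>M i\<bar>" using ab(2) by blast
    qed
    then show "N \<in> {N\<in>idx n. wt n N < wt n M}" using N(1) by simp
  qed
  finally have "proj n (wt n M) (sep S (?h(b := r))) = 0" by (rule proj_W_pred)
  then have "proj n (wt n M) (poisson n F G) = of_int (s * M b) *\<^sub>R trig_monomial n M"
    unfolding poisson using M
    by (simp add: linear_diff[OF linear_proj] linear_scale[OF linear_proj] proj_trig_monomial)
  moreover have "bracket_top n F G = proj n (wt n M) (poisson n F G)"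
    using bracket_top_V[OF V] wt(3) by simp
  ultimately show ?thesis
    using V wt(3) s ab(5) by (intro that[of F G "of_int (s * M b)"]) auto
qed

subsection \<open>The image of the boundary operator\<close>

lemma boundary_free_eq_sum:
  assumes "finite P" "{p. t p \<noteq> 0} \<subseteq> P"
  shows "boundary_free n t = (\<Sum>p\<in>P. t p *\<^sub>R (- bracket_top n (fst p) (snd p)))"
  unfolding boundary_free_def by (rule sum.mono_neutral_left) (use assms in auto)

text \<open>A sum over an infinite support defaults to 0, so additivity is stated for finite
  supports, and finiteness is propagated together with it.\<close>

lemma boundary_free_add:
  assumes "finite {p. t p \<noteq> 0}" "finite {p. t' p \<noteq> 0}"
  shows "finite {p. (t + t') p \<noteq> 0}"
    "boundary_free n (t + t') = boundary_free n t + boundary_free n t'"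
proof -
  let ?P = "{p. t p \<noteq> 0} \<union> {p. t' p \<noteq> 0}"
  have P: "finite ?P" "{p. (t + t') p \<noteq> 0} \<subseteq> ?P" using assms by auto
  then show "finite {p. (t + t') p \<noteq> 0}" by (rule finite_subset[rotated])
  have "{p. t p \<noteq> 0} \<subseteq> ?P" "{p. t' p \<noteq> 0} \<subseteq> ?P" by auto
  with P show "boundary_free n (t + t') = boundary_free n t + boundary_free n t'"
    by (simp only: boundary_free_eq_sum plus_fun_apply scaleR_add_left sum.distrib)
qed

lemma boundary_free_scale:
  assumes "finite {p. t p \<noteq> 0}"
  shows "finite {p. (c *\<^sub>R t) p \<noteq> 0}" "boundary_free n (c *\<^sub>R t) = c *\<^sub>R boundary_free n t"
proof -
  have sub: "{p. (c *\<^sub>R t) p \<noteq> 0} \<subseteq> {p. t p \<noteq> 0}" by auto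
  then show "finite {p. (c *\<^sub>R t) p \<noteq> 0}" using assms by (rule finite_subset)
  show "boundary_free n (c *\<^sub>R t) = c *\<^sub>R boundary_free n t"
    unfolding boundary_free_eq_sum[OF assms sub] boundary_free_eq_sum[OF assms order_refl]
    by (simp add: scaleR_sum_right)
qed

lemma boundary_free_diff:
  assumes "finite {p. t p \<noteq> 0}" "finite {p. t' p \<noteq> 0}"
  shows "finite {p. (t - t') p \<noteq> 0}"
    "boundary_free n (t - t') = boundary_free n t - boundary_free n t'"
proof -
  have eq: "t - t' = t + (-1) *\<^sub>R t'" by (simp add: fun_eq_iff)
  note add = boundary_free_add[OF assms(1) boundary_free_scale(1)[OF assms(2), of "-1"]]
  show "finite {p. (t - t') p \<noteq> 0}" unfolding eq by (rule add(1))
  show "boundary_free n (t - t') = boundary_free n t - boundary_free n t'"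
    unfolding eq add(2) boundary_free_scale(2)[OF assms(2)] by simp
qed

lemma boundary_free_gen:
  "finite {p. free_gen F G p \<noteq> 0}" "boundary_free n (free_gen F G) = - bracket_top n F G"
proof -
  have supp: "{p. free_gen F G p \<noteq> 0} = {(F, G)}" by (auto simp: free_gen_def)
  then show "finite {p. free_gen F G p \<noteq> 0}" by simp
  show "boundary_free n (free_gen F G) = - bracket_top n F G"
    unfolding boundary_free_def supp by (simp add: free_gen_def)
qed

lemma finite_support_span:
  assumes "t \<in> span A" "\<And>s. s \<in> A \<Longrightarrow> finite {p. s p \<noteq> 0} \<and> boundary_free n s \<in> span B"
  shows "finite {p. t p \<noteq> 0} \<and> boundary_free n t \<in> span B"
  using assms(1)
proof (rule span_induct_linear[where P = "\<lambda>t. finite {p. t p \<noteq> 0} \<and> boundary_free n t \<in> span B"])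
  show "finite {p. (0 :: tfun \<times> tfun \<Rightarrow> real) p \<noteq> 0} \<and> boundary_free n 0 \<in> span B"
    by (simp add: boundary_free_def span_zero)
qed (use assms(2) boundary_free_add boundary_free_scale in \<open>auto simp del: plus_fun_apply scaleR_fun_apply intro: span_add span_scale\<close>)

text \<open>Well-definedness of the boundary on cosets: bilinearity and skew symmetry of the top
  bracket annihilate each of the five kinds of relation.\<close>

lemma boundary_free_ext2_rel:
  assumes "t \<in> ext2_rel (V_pos n)"
  shows "finite {p. t p \<noteq> 0} \<and> boundary_free n t = 0"
proof -
  \<comment> \<open>Vanishing is expressed as membership in the zero space \<open>span {}\<close>,
    so that the lemma on spans applies.\<close>
  have "finite {p. t p \<noteq> 0} \<and> boundary_free n t \<in> span {}"
    using assms unfolding ext2_rel_def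
  proof (rule finite_support_span)
    have P: "F \<in> trig_poly n" if "F \<in> V_pos n" for F
      using that V_pos_subset_trig_poly by auto
    note fin = boundary_free_gen(1)
    have scale: "finite {p. (free_gen F G - c *\<^sub>R free_gen F' G') p \<noteq> 0}"
      "boundary_free n (free_gen F G - c *\<^sub>R free_gen F' G')
        = - bracket_top n F G - c *\<^sub>R (- bracket_top n F' G')" for F G F' G' c
      using boundary_free_diff[OF fin[of F G] boundary_free_scale(1)[OF fin[of F' G'], of c]]
      unfolding boundary_free_scale(2)[OF fin] boundary_free_gen(2) .
    have sum: "finite {p. (free_gen F G - free_gen F' G' - free_gen F'' G'') p \<noteq> 0}"
      "boundary_free n (free_gen F G - free_gen F' G' - free_gen F'' G'')
        = - bracket_top n F G - - bracket_top n F' G' - - bracket_top n F'' G''" for F G F' G' F'' G''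
      using boundary_free_diff[OF boundary_free_diff(1)[OF fin[of F G] fin[of F' G']] fin[of F'' G'']]
      unfolding boundary_free_diff(2)[OF fin fin] boundary_free_gen(2) .
    fix s
    assume "s \<in> {free_gen (u + u') v - free_gen u v - free_gen u' v | u u' v. u \<in> V_pos n \<and> u' \<in> V_pos n \<and> v \<in> V_pos n}
      \<union> {free_gen u (v + v') - free_gen u v - free_gen u v' | u v v'. u \<in> V_pos n \<and> v \<in> V_pos n \<and> v' \<in> V_pos n}
      \<union> {free_gen (c *\<^sub>R u) v - c *\<^sub>R free_gen u v | c u v. u \<in> V_pos n \<and> v \<in> V_pos n}
      \<union> {free_gen u (c *\<^sub>R v) - c *\<^sub>R free_gen u v | c u v. u \<in> V_pos n \<and> v \<in> V_pos n}
      \<union> {free_gen u u | u. u \<in> V_pos n}"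
    then consider
        (1) u u' v where "s = free_gen (u + u') v - free_gen u v - free_gen u' v" "u \<in> V_pos n" "u' \<in> V_pos n" "v \<in> V_pos n"
      | (2) u v v' where "s = free_gen u (v + v') - free_gen u v - free_gen u v'" "u \<in> V_pos n" "v \<in> V_pos n" "v' \<in> V_pos n"
      | (3) c u v where "s = free_gen (c *\<^sub>R u) v - c *\<^sub>R free_gen u v" "u \<in> V_pos n" "v \<in> V_pos n"
      | (4) c u v where "s = free_gen u (c *\<^sub>R v) - c *\<^sub>R free_gen u v" "u \<in> V_pos n" "v \<in> V_pos n"
      | (5) u where "s = free_gen u u" "u \<in> V_pos n"
      by blast
    then show "finite {p. s p \<noteq> 0} \<and> boundary_free n s \<in> span {}"
    proof cases
      case 1
      then have "boundary_free n s = 0"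
        unfolding 1(1) sum(2) using P by (simp add: bracket_top_add_left)
      then show ?thesis unfolding 1(1) using sum(1) span_zero by metis
    next
      case 2
      then have "boundary_free n s = 0"
        unfolding 2(1) sum(2) using P by (simp add: bracket_top_add_right)
      then show ?thesis unfolding 2(1) using sum(1) span_zero by metis
    next
      case 3
      then have "boundary_free n s = 0"
        unfolding 3(1) scale(2) using P by (simp add: bracket_top_scale_left)
      then show ?thesis unfolding 3(1) using scale(1) span_zero by metis
    next
      case 4
      then have "boundary_free n s = 0"
        unfolding 4(1) scale(2) using P by (simp add: bracket_top_scale_right)
      then show ?thesis unfolding 4(1) using scale(1) span_zero by metis
    next
      case 5
      then show ?thesis using P by (simp add: boundary_free_gen bracket_top_self)
    qed
  qed
  then show ?thesis by simp
qed

lemma boundary_ext2_coset: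
  assumes "finite {p. t p \<noteq> 0}"
  shows "boundary n (ext2_coset (V_pos n) t) = boundary_free n t"
proof -
  have "boundary_free n (t + r) = boundary_free n t" if "r \<in> ext2_rel (V_pos n)" for r
    using boundary_free_ext2_rel[OF that] boundary_free_add(2)[OF assms] by simp
  \<comment> \<open>This makes the coset nonempty, so the image is exactly a singleton and
    \<open>the_elem\<close> is determined.\<close>
  moreover have "0 \<in> ext2_rel (V_pos n)" by (simp add: ext2_rel_def span_zero)
  ultimately have "boundary_free n ` ext2_coset (V_pos n) t = {boundary_free n t}"
    unfolding ext2_coset_def by force
  then show ?thesis by (simp add: boundary_def)
qed

text \<open>The top part of a bracket involves only mixed monomials, and conversely each mixed
  monomial is a multiple of a single bracket.\<close>

lemma boundary_image_C2:
  "boundary n ` C2 n w = span (trig_monomial n ` {M\<in>idx n. wt n M = w \<and> mixed n M})"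
proof -
  define A where "A = {free_gen F G | F G. \<exists>i j. 1 \<le> i \<and> 1 \<le> j \<and> i + j = w \<and> F \<in> V n i \<and> G \<in> V n j}"
  let ?B = "trig_monomial n ` {M\<in>idx n. wt n M = w \<and> mixed n M}"
  have A: "finite {p. s p \<noteq> 0} \<and> boundary_free n s \<in> span ?B" if s_in: "s \<in> A" for s
  proof -
    obtain F G i j where s: "s = free_gen F G" "i + j = w" "F \<in> V n i" "G \<in> V n j"
      using s_in unfolding A_def by blast
    show ?thesis
      using boundary_free_gen(1)[of F G] boundary_free_gen(2)[of n F G] proj_poisson_in_span_mixed[OF s(3,4)] bracket_top_V[OF s(3,4)]
      by (simp add: s(1) s(2)[symmetric] span_neg)
  qed
  then have spanA: "finite {p. t p \<noteq> 0} \<and> boundary_free n t \<in> span ?B" if "t \<in> span A" for t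
    using that by (rule finite_support_span[rotated])
  have "boundary n ` C2 n w = boundary_free n ` span A"
    unfolding C2_def A_def[symmetric] image_image
    by (rule image_cong) (use spanA boundary_ext2_coset in auto)
  also have "\<dots> = span ?B"
  proof
    show "boundary_free n ` span A \<subseteq> span ?B" using spanA by auto
    \<comment> \<open>\<open>boundary_free\<close> is linear only on finite supports, so the closure
      properties are checked directly, using that elements of \<open>span A\<close> have finite
      support.\<close>
    have "subspace (boundary_free n ` span A)"
    proof (rule subspaceI)
      show "0 \<in> boundary_free n ` span A"
        by (rule image_eqI[OF _ span_zero]) (simp add: boundary_free_def)
      show "x + y \<in> boundary_free n ` span A"
        if xy: "x \<in> boundary_free n ` span A" "y \<in> boundary_free n ` span A" for x y
      proof -
        obtain t u where tu: "t \<in> span A" "u \<in> span A" "x = boundary_free n t" "y = boundary_free n u"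
          using xy by blast
        then show ?thesis
          using boundary_free_add(2)[of t u n] spanA by (intro image_eqI[OF _ span_add[OF tu(1,2)]]) auto
      qed
      show "c *\<^sub>R x \<in> boundary_free n ` span A" if x: "x \<in> boundary_free n ` span A" for c x
      proof -
        obtain t where t: "t \<in> span A" "x = boundary_free n t" using x by blast
        then show ?thesis
          using boundary_free_scale(2)[of t n c] spanA by (intro image_eqI[OF _ span_scale[OF t(1), of c]]) auto
      qed
    qed
    moreover have "trig_monomial n M \<in> boundary_free n ` span A"
      if M: "M \<in> idx n" "wt n M = w" "mixed n M" for M
    proof -
      obtain F G c where FG: "F \<in> V n 1" "G \<in> V n (w - 1)" "w \<ge> 2" "c \<noteq> 0"
        "bracket_top n F G = c *\<^sub>R trig_monomial n M"
        using trig_monomial_mixed_as_bracket[OF M(1,3)] M(2) by metis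
      \<comment> \<open>Weight at least 2 leaves \<open>G\<close> with positive weight
        \<open>w - 1\<close>, as the chain space demands.\<close>
      then have "free_gen F G \<in> A"
        unfolding A_def by (intro CollectI exI[of _ F] exI[of _ G] conjI refl exI[of _ 1] exI[of _ "w - 1"]) auto
      \<comment> \<open>The factor cancels both the coefficient \<open>c\<close> and the sign in the
        boundary.\<close>
      then have "(- 1 / c) *\<^sub>R free_gen F G \<in> span A" by (intro span_scale span_base)
      moreover have "boundary_free n ((- 1 / c) *\<^sub>R free_gen F G) = trig_monomial n M"
        unfolding boundary_free_scale(2)[OF boundary_free_gen(1)] boundary_free_gen(2) FG(5)
        using FG(4) by simp
      ultimately show ?thesis by (metis image_eqI)
    qed
    ultimately show "span ?B \<subseteq> boundary_free n ` span A"
      by (intro span_minimal) auto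
  qed
  finally show ?thesis .
qed

subsection \<open>Counting monomials without conjugate pairs\<close>

definition unmixed :: "nat \<Rightarrow> nat \<Rightarrow> (nat \<Rightarrow> int) set" where
  "unmixed n w = {M\<in>idx n. wt n M = w \<and> \<not> mixed n M}"

lemma dim_span_trig_monomial:
  assumes "A \<subseteq> idx n"
  shows "dim (span (trig_monomial n ` A)) = card A"
proof -
  have "independent (trig_monomial n ` A)"
    by (rule independent_mono[OF independent_trig_monomial]) (use assms in blast)
  then have "dim (span (trig_monomial n ` A)) = card (trig_monomial n ` A)"
    by (rule dim_span_eq_card_independent)
  also have "\<dots> = card A"
    using inj_on_subset[OF inj_on_trig_monomial assms] by (rule card_image)
  finally show ?thesis .
qed

text \<open>The chain space and the image of the boundary are spanned by parts of the same basis, so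
  the difference of dimensions counts the complementary indices.\<close>

lemma Corank1_eq_card_unmixed: "Corank1 w n = int (card (unmixed n w))"
proof -
  have "{M\<in>idx n. wt n M = w} = unmixed n w \<union> {M\<in>idx n. wt n M = w \<and> mixed n M}"
    by (auto simp: unmixed_def)
  moreover have "finite {M\<in>idx n. wt n M = w}"
    by (rule finite_subset[OF _ finite_idx_wt[of n w]]) auto
  ultimately have "card {M\<in>idx n. wt n M = w} = card (unmixed n w) + card {M\<in>idx n. wt n M = w \<and> mixed n M}"
    by (subst card_Un_disjoint[symmetric]) (auto simp: unmixed_def)
  moreover have "dim (C1 n w) = card {M\<in>idx n. wt n M = w}"
    unfolding C1_def V_eq_span_trig_monomial by (rule dim_span_trig_monomial) auto
  moreover have "dim (boundary n ` C2 n w) = card {M\<in>idx n. wt n M = w \<and> mixed n M}"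
    unfolding boundary_image_C2 by (rule dim_span_trig_monomial) auto
  ultimately show ?thesis by (simp add: Corank1_def)
qed

lemma unmixed_weight_zero: "unmixed n 0 = {\<lambda>_. 0}"
proof
  show "unmixed n 0 \<subseteq> {\<lambda>_. 0}"
  proof
    fix M assume M: "M \<in> unmixed n 0"
    have "M = (\<lambda>_. 0)"
    proof (rule idx_eqI)
      show "M \<in> idx n" "(\<lambda>_. 0) \<in> idx n" using M by (auto simp: unmixed_def idx_def)
      show "M i = 0" if "i \<in> {1..2*n}" for i
        using nat_abs_le_wt[OF that, of M] M by (simp add: unmixed_def)
    qed
    then show "M \<in> {\<lambda>_. 0}" by simp
  qed
qed (auto simp: unmixed_def idx_def wt_def mixed_def)

text \<open>The four points at distance \<open>d\<close> from the origin on the two axes are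
  distinct for positive \<open>d\<close> and coincide for \<open>d = 0\<close>.\<close>

lemma card_axis_points:
  "card {(p, q). (p = 0 \<or> q = (0::int)) \<and> nat \<bar>p :: int\<bar> + nat \<bar>q\<bar> = d} = (if d = 0 then 1 else 4)"
proof -
  have "{(p, q). (p = 0 \<or> q = (0::int)) \<and> nat \<bar>p :: int\<bar> + nat \<bar>q\<bar> = d}
      = {(int d, 0), (- int d, 0), (0, int d), (0, - int d)}"
    by (auto split: if_splits)
  then show ?thesis by auto
qed

text \<open>Being unmixed is a condition on each pair separately. Splitting off the last pair, of
  degree \<open>w - i\<close>, leaves an unmixed index of weight \<open>i\<close> on the smaller
  torus.\<close>

lemma card_unmixed_Suc:
  "card (unmixed (Suc n) w) = (\<Sum>i\<le>w. (if i = w then 1 else 4) * card (unmixed n i))"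
proof -
  define D where "D = (\<lambda>d. {(p, q). (p = 0 \<or> q = (0::int)) \<and> nat \<bar>p :: int\<bar> + nat \<bar>q\<bar> = d})"
  let ?a = "Suc (2*n)" and ?b = "Suc (Suc (2*n))"
  have set: "{1..2 * Suc n} = insert ?b (insert ?a {1..2*n})" by auto
  have wt_Suc: "wt (Suc n) M = wt n M + nat \<bar>M ?a\<bar> + nat \<bar>M ?b\<bar>" for M
    unfolding wt_def set by simp
  have "{1..Suc n} = insert (Suc n) {1..n}" by auto
  then have mixed_Suc: "mixed (Suc n) M \<longleftrightarrow> mixed n M \<or> M ?a \<noteq> 0 \<and> M ?b \<noteq> 0" for M
    unfolding mixed_def by auto
  have wt_upd: "wt n (M(?a := p, ?b := q)) = wt n M" for M p q
    unfolding wt_def by (rule sum.cong) auto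
  have mixed_upd: "mixed n (M(?a := p, ?b := q)) \<longleftrightarrow> mixed n M" for M p q
    unfolding mixed_def by (rule bex_cong) auto
  have idx_upd: "M(?a := 0, ?b := 0) \<in> idx n" if "M \<in> idx (Suc n)" for M
    using that unfolding idx_def set by auto
  have idx_upd': "M(?a := p, ?b := q) \<in> idx (Suc n)" if "M \<in> idx n" for M p q
    using that unfolding idx_def set by auto
  have idx_zero: "M ?a = 0" "M ?b = 0" if "M \<in> idx n" for M
    using that unfolding idx_def by auto
  let ?S = "SIGMA i:{..w}. D (w - i) \<times> unmixed n i"
  have "bij_betw (\<lambda>(i, (p, q), M). M(?a := p, ?b := q)) ?S (unmixed (Suc n) w)"
  proof (rule bij_betw_byWitness[where f' = "\<lambda>M. (wt n M, (M ?a, M ?b), M(?a := 0, ?b := 0))"])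
    show "\<forall>x\<in>?S. (\<lambda>M. (wt n M, (M ?a, M ?b), M(?a := 0, ?b := 0)))
        ((\<lambda>(i, (p, q), M). M(?a := p, ?b := q)) x) = x"
    proof
      fix x assume "x \<in> ?S"
      then obtain i p q M where x: "x = (i, (p, q), M)" and "M \<in> unmixed n i" by auto
      then have M: "wt n M = i" "M ?a = 0" "M ?b = 0"
        using idx_zero by (auto simp: unmixed_def)
      have "M(?a := 0, ?b := 0) = M" using M(2,3) by (auto simp: fun_eq_iff)
      then have "(wt n (M(?a := p, ?b := q)), ((M(?a := p, ?b := q)) ?a, (M(?a := p, ?b := q)) ?b),
          M(?a := p, ?b := q, ?a := 0, ?b := 0)) = (i, (p, q), M)"
        unfolding wt_upd M(1) by (simp add: fun_upd_twist)
      then show "(\<lambda>M. (wt n M, (M ?a, M ?b), M(?a := 0, ?b := 0)))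
        ((\<lambda>(i, (p, q), M). M(?a := p, ?b := q)) x) = x"
        unfolding x prod.case .
    qed
    show "\<forall>M\<in>unmixed (Suc n) w. (\<lambda>(i, (p, q), M). M(?a := p, ?b := q))
        (wt n M, (M ?a, M ?b), M(?a := 0, ?b := 0)) = M"
      by (auto simp: fun_eq_iff)
    show "(\<lambda>(i, (p, q), M). M(?a := p, ?b := q)) ` ?S \<subseteq> unmixed (Suc n) w"
      by (auto simp: unmixed_def D_def wt_Suc wt_upd mixed_Suc mixed_upd idx_upd')
    show "(\<lambda>M. (wt n M, (M ?a, M ?b), M(?a := 0, ?b := 0))) ` unmixed (Suc n) w \<subseteq> ?S"
      by (auto simp: unmixed_def D_def wt_Suc wt_upd mixed_Suc mixed_upd idx_upd)
  qed
  then have "card (unmixed (Suc n) w) = card ?S"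
    by (rule bij_betw_same_card[symmetric])
  also have "\<dots> = (\<Sum>i\<le>w. card (D (w - i) \<times> unmixed n i))"
  proof (rule card_SigmaI)
    have "finite (unmixed n i)" for i
      by (rule finite_subset[OF _ finite_idx_wt[of n i]]) (auto simp: unmixed_def)
    \<comment> \<open>An infinite set has cardinality 0, so the positive count already implies
      finiteness.\<close>
    moreover have "finite (D d)" for d
      using card_axis_points[of d] unfolding D_def by (intro card_ge_0_finite) simp
    ultimately show "\<forall>i\<in>{..w}. finite (D (w - i) \<times> unmixed n i)" by simp
  qed simp
  also have "\<dots> = (\<Sum>i\<le>w. (if i = w then 1 else 4) * card (unmixed n i))"
    unfolding card_cartesian_product D_def card_axis_points by (rule sum.cong) auto
  finally show ?thesis .
qed

theorem theorem5p2:
  shows "(\<forall>n::nat. n \<ge> 1 \<longrightarrow> Corank1 0 n = 1) \<and>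
         (\<forall>n w::nat. n \<ge> 2 \<longrightarrow>
            Corank1 w n = 4 + 4 * (\<Sum>i=1..w. Corank1 i (n - 1)) - 3 * Corank1 w (n - 1))"
proof (intro conjI allI impI)
  have zero: "Corank1 0 n = 1" for n
    by (simp add: Corank1_eq_card_unmixed unmixed_weight_zero)
  then show "Corank1 0 n = 1" for n .
  fix n w :: nat
  assume "n \<ge> 2"
  then obtain m where m: "n = Suc m" by (cases n) auto
  \<comment> \<open>The coefficient 1 at \<open>i = w\<close> is written as 4 - 3, the origin of the
    subtracted term.\<close>
  have "Corank1 w n = (\<Sum>i\<le>w. 4 * Corank1 i m - (if i = w then 3 * Corank1 i m else 0))"
    unfolding Corank1_eq_card_unmixed m card_unmixed_Suc of_nat_sum by (rule sum.cong) auto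
  also have "\<dots> = 4 * (\<Sum>i\<le>w. Corank1 i m) - 3 * Corank1 w m"
    by (simp add: sum_subtractf sum_distrib_left)
  \<comment> \<open>The term at \<open>i = 0\<close> equals 1 and yields the constant 4.\<close>
  also have "(\<Sum>i\<le>w. Corank1 i m) = 1 + (\<Sum>i=1..w. Corank1 i m)"
    by (simp add: zero atMost_atLeast0 sum.atLeast_Suc_atMost)
  finally show "Corank1 w n = 4 + 4 * (\<Sum>i=1..w. Corank1 i (n - 1)) - 3 * Corank1 w (n - 1)"
    by (simp add: m)
qed

end
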